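(* If $V$, $W$ and $X$ are operator spaces, then there is a natural isometric identification $$CB(V\otimes^s W, X)= SB(V\times W, X),$$ under which a completely bounded map $\psi:V\otimes^sW\to X$ corresponds to the schur bounded bilinear map $(v,w)\mapsto\psi(v\otimes w)$.
   Context: An operator space is a closed subspace of $B(H)$ with the inherited matrix norms. For $x=[x_{ij}]\in M_n(V)$ and $y=[y_{ij}]\in M_n(W)$ put $x\circ y=[x_{ij}\otimes y_{ij}]\in M_n(V\otimes W)$. For $u\in M_p(V\otimes W)$, $\|u\|_s=\inf\{\|\alpha\|\|x\|\|y\|\|\beta\|\}$, the infimum over all decompositions $u=\alpha(x\circ y)\beta$ with $n\in\mathbb{N}$, $x\in M_n(V)$, $y\in M_n(W)$, $\alpha\in M_{p,n}(\mathbb{C})$, $\beta\in M_{n,p}(\mathbb{C})$. $V\otimes^sW$ is the completion of $V\otimes W$ for these matrix norms (an operator space). $CB(\cdot,\cdot)$ is the space of completely bounded linear maps with the cb norm. A bilinear map $\varphi:V\times W\to X$ is schur bounded if the maps $\varphi_n:M_n(V)\times M_n(W)\to M_n(X)$, $\varphi_n([v_{ij}],[w_{ij}])=[\varphi(v_{ij},w_{ij})]$, $n\in\mathbb{N}$, are uniformly bounded; $\|\varphi\|_{sb}=\sup_n\|\varphi_n\|$, and $SB(V\times W,X)$ is the space of schur bounded bilinear maps with norm $\|\cdot\|_{sb}$. *)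

theory Defs
  imports "HOL-Analysis.Analysis" "HOL-Library.Poly_Mapping"
begin

section \<open>Complex Hilbert spaces and their bounded operators\<close>

class scaleC =
  fixes scaleC :: "complex \<Rightarrow> 'a \<Rightarrow> 'a" (infixr "*\<^sub>C" 75)

class complex_vector = ab_group_add + scaleC +
  assumes scaleC_add_right: "a *\<^sub>C (x + y) = a *\<^sub>C x + a *\<^sub>C y"
    and scaleC_add_left: "(a + b) *\<^sub>C x = a *\<^sub>C x + b *\<^sub>C x"
    and scaleC_scaleC: "a *\<^sub>C (b *\<^sub>C x) = (a * b) *\<^sub>C x"
    and scaleC_one: "1 *\<^sub>C x = x"

global_interpretation cvs: vector_space "scaleC :: complex \<Rightarrow> 'a \<Rightarrow> 'a :: complex_vector"
  by unfold_locales (simp_all add: scaleC_add_right scaleC_add_left scaleC_scaleC scaleC_one)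

class complex_normed_vector = complex_vector + real_normed_vector +
  assumes scaleR_scaleC: "r *\<^sub>R x = complex_of_real r *\<^sub>C x"
    and norm_scaleC: "norm (a *\<^sub>C x) = cmod a * norm x"

text \<open>Positivity and definiteness of \<open>cinner\<close> follow from \<open>cinner_norm\<close>; the second argument is the
  linear one.\<close>

class chilbert_space = complex_normed_vector + banach +
  fixes cinner :: "'a \<Rightarrow> 'a \<Rightarrow> complex"
  assumes cinner_commute: "cinner x y = cnj (cinner y x)"
    and cinner_add_right: "cinner x (y + z) = cinner x y + cinner x z"
    and cinner_scaleC_right: "cinner x (a *\<^sub>C y) = a * cinner x y"
    and cinner_norm: "cinner x x = complex_of_real ((norm x)\<^sup>2)"

instantiation complex :: chilbert_space
begin
definition scaleC_complex :: "complex \<Rightarrow> complex \<Rightarrow> complex" where "scaleC_complex a x = a * x"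
definition cinner_complex :: "complex \<Rightarrow> complex \<Rightarrow> complex" where "cinner_complex x y = cnj x * y"
instance
  by standard
    (auto simp: scaleC_complex_def cinner_complex_def algebra_simps scaleR_conv_of_real norm_mult
      complex_norm_square[symmetric])
end

instantiation blinfun :: (real_normed_vector, complex_normed_vector) complex_vector
begin

lift_definition scaleC_blinfun :: "complex \<Rightarrow> ('a \<Rightarrow>\<^sub>L 'b) \<Rightarrow> ('a \<Rightarrow>\<^sub>L 'b)" is "\<lambda>c f x. c *\<^sub>C f x"
proof -
  fix c :: complex and f :: "'a \<Rightarrow> 'b" assume f: "bounded_linear f"
  interpret f: bounded_linear f by (fact f)
  obtain K where K: "\<And>x. norm (f x) \<le> norm x * K" using f.bounded by blast
  show "bounded_linear (\<lambda>x. c *\<^sub>C f x)"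
  proof
    show "c *\<^sub>C f (x + y) = c *\<^sub>C f x + c *\<^sub>C f y" for x y
      by (simp add: f.add scaleC_add_right)
    show "c *\<^sub>C f (r *\<^sub>R x) = r *\<^sub>R (c *\<^sub>C f x)" for r x
      by (simp add: f.scaleR scaleR_scaleC scaleC_scaleC mult.commute)
    show "\<exists>K. \<forall>x. norm (c *\<^sub>C f x) \<le> norm x * K"
    proof (intro exI allI)
      fix x
      have "cmod c * norm (f x) \<le> cmod c * (norm x * K)" by (intro mult_left_mono K) simp
      then show "norm (c *\<^sub>C f x) \<le> norm x * (cmod c * K)"
        by (simp add: norm_scaleC algebra_simps)
    qed
  qed
qed

instance
proof
  fix a b :: complex and x y :: "'a \<Rightarrow>\<^sub>L 'b"
  show "a *\<^sub>C (x + y) = a *\<^sub>C x + a *\<^sub>C y" by transfer (simp add: scaleC_add_right)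
  show "(a + b) *\<^sub>C x = a *\<^sub>C x + b *\<^sub>C x" by transfer (simp add: scaleC_add_left)
  show "a *\<^sub>C (b *\<^sub>C x) = (a * b) *\<^sub>C x" by transfer (simp add: scaleC_scaleC)
  show "1 *\<^sub>C x = x" by transfer (simp add: scaleC_one)
qed

end

instance blinfun :: (real_normed_vector, complex_normed_vector) complex_normed_vector
proof
  fix a :: complex and x :: "'a \<Rightarrow>\<^sub>L 'b" and r :: real
  show "r *\<^sub>R x = complex_of_real r *\<^sub>C x" by transfer (simp add: scaleR_scaleC)
  show "norm (a *\<^sub>C x) = cmod a * norm x"
  proof (cases "a = 0")
    case True
    then show ?thesis by simp
  next
    case False
    have le: "norm (c *\<^sub>C z) \<le> cmod c * norm z" for c and z :: "'a \<Rightarrow>\<^sub>L 'b"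
    proof (rule norm_blinfun_bound)
      fix \<xi>
      have "norm (blinfun_apply z \<xi>) \<le> norm z * norm \<xi>" by (rule norm_blinfun)
      then show "norm (blinfun_apply (c *\<^sub>C z) \<xi>) \<le> cmod c * norm z * norm \<xi>"
        by (simp add: scaleC_blinfun.rep_eq norm_scaleC mult.assoc mult_left_mono)
    qed simp
    have "norm x = norm (inverse a *\<^sub>C (a *\<^sub>C x))" using False by simp
    also have "\<dots> \<le> cmod (inverse a) * norm (a *\<^sub>C x)" by (rule le)
    finally have "cmod a * norm x \<le> norm (a *\<^sub>C x)"
      using False by (simp add: norm_inverse norm_divide field_simps)
    with le[of a x] show ?thesis by simp
  qed
qed

text \<open>The type \<open>'h \<Rightarrow>\<^sub>L 'h\<close> consists of the real-linear bounded operators; \<open>B(H)\<close> is the closed complex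
  subspace of those that are complex-linear.\<close>

definition bounded_ops :: "('h::chilbert_space \<Rightarrow>\<^sub>L 'h) set" where
  "bounded_ops = {T. \<forall>c \<xi>. blinfun_apply T (c *\<^sub>C \<xi>) = c *\<^sub>C blinfun_apply T \<xi>}"

definition operator_space :: "('h::chilbert_space \<Rightarrow>\<^sub>L 'h) set \<Rightarrow> bool" where
  "operator_space V \<longleftrightarrow> V \<subseteq> bounded_ops \<and> cvs.subspace V \<and> closed V"


section \<open>Matrix norms\<close>

text \<open>A matrix is a function of two indices of which only the values at indices below its format
  matter.\<close>

definition mats :: "nat \<Rightarrow> 'a set \<Rightarrow> (nat \<Rightarrow> nat \<Rightarrow> 'a) set" where
  "mats n S = {x. \<forall>i<n. \<forall>j<n. x i j \<in> S}"

text \<open>The operator norm of a \<open>p \<times> n\<close> matrix whose entries act from \<open>'a\<close> to \<open>'b\<close>, as a map from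
  the Hilbert sum of \<open>n\<close> copies of \<open>'a\<close> to that of \<open>p\<close> copies of \<open>'b\<close>.\<close>

definition mat_opnorm ::
    "('e \<Rightarrow> 'a::real_normed_vector \<Rightarrow> 'b::real_normed_vector) \<Rightarrow> nat \<Rightarrow> nat \<Rightarrow> (nat \<Rightarrow> nat \<Rightarrow> 'e) \<Rightarrow> real"
  where
  "mat_opnorm act p n x =
     (SUP \<xi> \<in> {\<xi> :: nat \<Rightarrow> 'a. L2_set (\<lambda>j. norm (\<xi> j)) {..<n} \<le> 1}.
        L2_set (\<lambda>i. norm (\<Sum>j<n. act (x i j) (\<xi> j))) {..<p})"

abbreviation scalar_mat_norm :: "nat \<Rightarrow> nat \<Rightarrow> (nat \<Rightarrow> nat \<Rightarrow> complex) \<Rightarrow> real" where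
  "scalar_mat_norm \<equiv> mat_opnorm (*)"

abbreviation op_mat_norm :: "nat \<Rightarrow> (nat \<Rightarrow> nat \<Rightarrow> ('h::chilbert_space \<Rightarrow>\<^sub>L 'h)) \<Rightarrow> real" where
  "op_mat_norm n \<equiv> mat_opnorm blinfun_apply n n"

record 'a matricial_space =
  pts :: "'a set"
  add :: "'a \<Rightarrow> 'a \<Rightarrow> 'a"
  scl :: "complex \<Rightarrow> 'a \<Rightarrow> 'a"
  mnorm :: "nat \<Rightarrow> (nat \<Rightarrow> nat \<Rightarrow> 'a) \<Rightarrow> real"

definition opspace :: "('h::chilbert_space \<Rightarrow>\<^sub>L 'h) set \<Rightarrow> ('h \<Rightarrow>\<^sub>L 'h) matricial_space" where
  "opspace V = \<lparr>pts = V, add = (+), scl = scaleC, mnorm = op_mat_norm\<rparr>"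


section \<open>Completely bounded and schur bounded maps\<close>

text \<open>Maps are extensional, so that equality of elements of \<open>CB\<close> and \<open>SB\<close> is equality of maps on
  the given domains.\<close>

definition linear_map :: "'a matricial_space \<Rightarrow> 'b matricial_space \<Rightarrow> ('a \<Rightarrow> 'b) \<Rightarrow> bool" where
  "linear_map E F \<psi> \<longleftrightarrow> \<psi> \<in> pts E \<rightarrow>\<^sub>E pts F \<and>
     (\<forall>x\<in>pts E. \<forall>y\<in>pts E. \<psi> (add E x y) = add F (\<psi> x) (\<psi> y)) \<and>
     (\<forall>c. \<forall>x\<in>pts E. \<psi> (scl E c x) = scl F c (\<psi> x))"

definition bilinear_map ::
    "'a matricial_space \<Rightarrow> 'b matricial_space \<Rightarrow> 'c matricial_space \<Rightarrow> ('a \<times> 'b \<Rightarrow> 'c) \<Rightarrow> bool" where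
  "bilinear_map V W X \<phi> \<longleftrightarrow> \<phi> \<in> pts V \<times> pts W \<rightarrow>\<^sub>E pts X \<and>
     (\<forall>v\<in>pts V. \<forall>v'\<in>pts V. \<forall>w\<in>pts W. \<phi> (add V v v', w) = add X (\<phi> (v, w)) (\<phi> (v', w))) \<and>
     (\<forall>v\<in>pts V. \<forall>w\<in>pts W. \<forall>w'\<in>pts W. \<phi> (v, add W w w') = add X (\<phi> (v, w)) (\<phi> (v, w'))) \<and>
     (\<forall>c. \<forall>v\<in>pts V. \<forall>w\<in>pts W. \<phi> (scl V c v, w) = scl X c (\<phi> (v, w))) \<and>
     (\<forall>c. \<forall>v\<in>pts V. \<forall>w\<in>pts W. \<phi> (v, scl W c w) = scl X c (\<phi> (v, w)))"

definition CB :: "'a matricial_space \<Rightarrow> 'b matricial_space \<Rightarrow> ('a \<Rightarrow> 'b) set" where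
  "CB E F = {\<psi>. linear_map E F \<psi> \<and>
     (\<exists>C. \<forall>n\<ge>1. \<forall>x\<in>mats n (pts E). mnorm F n (\<lambda>i j. \<psi> (x i j)) \<le> C * mnorm E n x)}"

definition cb_norm :: "'a matricial_space \<Rightarrow> 'b matricial_space \<Rightarrow> ('a \<Rightarrow> 'b) \<Rightarrow> real" where
  "cb_norm E F \<psi> =
     (SUP n\<in>{1..}. SUP x\<in>{x \<in> mats n (pts E). mnorm E n x \<le> 1}. mnorm F n (\<lambda>i j. \<psi> (x i j)))"

definition SB ::
    "'a matricial_space \<Rightarrow> 'b matricial_space \<Rightarrow> 'c matricial_space \<Rightarrow> ('a \<times> 'b \<Rightarrow> 'c) set" where
  "SB V W X = {\<phi>. bilinear_map V W X \<phi> \<and>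
     (\<exists>C. \<forall>n\<ge>1. \<forall>v\<in>mats n (pts V). \<forall>w\<in>mats n (pts W).
        mnorm X n (\<lambda>i j. \<phi> (v i j, w i j)) \<le> C * mnorm V n v * mnorm W n w)}"

definition sb_norm ::
    "'a matricial_space \<Rightarrow> 'b matricial_space \<Rightarrow> 'c matricial_space \<Rightarrow> ('a \<times> 'b \<Rightarrow> 'c) \<Rightarrow> real" where
  "sb_norm V W X \<phi> =
     (SUP n\<in>{1..}. SUP (v, w)\<in>{v \<in> mats n (pts V). mnorm V n v \<le> 1} \<times>
                             {w \<in> mats n (pts W). mnorm W n w \<le> 1}.
        mnorm X n (\<lambda>i j. \<phi> (v i j, w i j)))"


section \<open>The algebraic tensor product\<close>

text \<open>The free complex vector space on a set of pairs, modulo the relations that make the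
  canonical map bilinear.\<close>

instantiation poly_mapping :: (type, complex_vector) complex_vector
begin
definition scaleC_poly_mapping :: "complex \<Rightarrow> ('a \<Rightarrow>\<^sub>0 'b) \<Rightarrow> ('a \<Rightarrow>\<^sub>0 'b)" where
  "scaleC_poly_mapping c f = Poly_Mapping.map (scaleC c) f"

lemma lookup_scaleC: "Poly_Mapping.lookup (c *\<^sub>C f) k = c *\<^sub>C Poly_Mapping.lookup f k"
  for f :: "'a \<Rightarrow>\<^sub>0 'b"
  by (simp add: scaleC_poly_mapping_def Poly_Mapping.map.rep_eq when_def)

instance
proof
  fix a b :: complex and f g :: "'a \<Rightarrow>\<^sub>0 'b"
  show "a *\<^sub>C (f + g) = a *\<^sub>C f + a *\<^sub>C g"
    by (rule poly_mapping_eqI) (simp add: lookup_scaleC lookup_add scaleC_add_right)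
  show "(a + b) *\<^sub>C f = a *\<^sub>C f + b *\<^sub>C f"
    by (rule poly_mapping_eqI) (simp add: lookup_scaleC lookup_add scaleC_add_left)
  show "a *\<^sub>C (b *\<^sub>C f) = (a * b) *\<^sub>C f"
    by (rule poly_mapping_eqI) (simp add: lookup_scaleC scaleC_scaleC)
  show "1 *\<^sub>C f = f"
    by (rule poly_mapping_eqI) (simp add: lookup_scaleC scaleC_one)
qed
end

abbreviation fpair :: "'a \<Rightarrow> 'b \<Rightarrow> 'a \<times> 'b \<Rightarrow>\<^sub>0 complex" where
  "fpair v w \<equiv> Poly_Mapping.single (v, w) 1"

definition tensor_relations :: "('a::complex_vector \<times> 'b::complex_vector \<Rightarrow>\<^sub>0 complex) set" where
  "tensor_relations = cvs.span
     ({fpair (v + v') w - fpair v w - fpair v' w | v v' w. True} \<union>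
      {fpair v (w + w') - fpair v w - fpair v w' | v w w'. True} \<union>
      {fpair (c *\<^sub>C v) w - c *\<^sub>C fpair v w | c v w. True} \<union>
      {fpair v (c *\<^sub>C w) - c *\<^sub>C fpair v w | c v w. True})"

definition tensor_rel ::
    "('a::complex_vector \<times> 'b::complex_vector \<Rightarrow>\<^sub>0 complex) \<Rightarrow> ('a \<times> 'b \<Rightarrow>\<^sub>0 complex) \<Rightarrow> bool" where
  "tensor_rel f g \<longleftrightarrow> f - g \<in> tensor_relations"

lemma tensor_rel_refl: "tensor_rel f f"
  by (simp add: tensor_rel_def tensor_relations_def cvs.span_zero)

lemma tensor_rel_add: "tensor_rel (f + f') (g + g')" if "tensor_rel f g" "tensor_rel f' g'"
  using cvs.span_add[OF that[unfolded tensor_rel_def tensor_relations_def]]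
  by (simp add: tensor_rel_def tensor_relations_def add_diff_add)

lemma tensor_rel_scaleC: "tensor_rel (c *\<^sub>C f) (c *\<^sub>C g)" if "tensor_rel f g"
  using cvs.span_scale[OF that[unfolded tensor_rel_def tensor_relations_def], of c]
  by (simp add: tensor_rel_def tensor_relations_def cvs.scale_right_diff_distrib)

lemma tensor_rel_minus: "tensor_rel (- f) (- g)" if "tensor_rel f g"
  using tensor_rel_scaleC[OF that, of "- 1"] by simp

lemma tensor_rel_diff: "tensor_rel (f - f') (g - g')" if "tensor_rel f g" "tensor_rel f' g'"
  using tensor_rel_add[OF that(1) tensor_rel_minus[OF that(2)]] by simp

lemma tensor_rel_sym: "tensor_rel g f" if "tensor_rel f g"
  using cvs.span_neg[OF that[unfolded tensor_rel_def tensor_relations_def]]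
  by (simp add: tensor_rel_def tensor_relations_def)

lemma tensor_rel_trans: "tensor_rel f h" if "tensor_rel f g" "tensor_rel g h"
  using cvs.span_add[OF that[unfolded tensor_rel_def tensor_relations_def]]
  by (simp add: tensor_rel_def tensor_relations_def)

lemma equivp_tensor_rel: "equivp tensor_rel"
  by (rule equivpI[OF reflpI sympI transpI])
    (rule tensor_rel_refl, erule tensor_rel_sym, erule (1) tensor_rel_trans)

quotient_type (overloaded) ('a, 'b) tensor =
  "'a::complex_vector \<times> 'b::complex_vector \<Rightarrow>\<^sub>0 complex" / tensor_rel
  by (rule equivp_tensor_rel)

instantiation tensor :: (complex_vector, complex_vector) complex_vector
begin

lift_definition zero_tensor :: "('a, 'b) tensor" is 0 .

lift_definition plus_tensor :: "('a, 'b) tensor \<Rightarrow> ('a, 'b) tensor \<Rightarrow> ('a, 'b) tensor" is "(+)"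
  by (rule tensor_rel_add)

lift_definition uminus_tensor :: "('a, 'b) tensor \<Rightarrow> ('a, 'b) tensor" is uminus
  by (rule tensor_rel_minus)

lift_definition minus_tensor :: "('a, 'b) tensor \<Rightarrow> ('a, 'b) tensor \<Rightarrow> ('a, 'b) tensor" is "(-)"
  by (rule tensor_rel_diff)

lift_definition scaleC_tensor :: "complex \<Rightarrow> ('a, 'b) tensor \<Rightarrow> ('a, 'b) tensor" is scaleC
  by (rule tensor_rel_scaleC)

instance
proof
  fix a b :: complex and x y z :: "('a, 'b) tensor"
  show "x + y + z = x + (y + z)" by transfer (simp add: tensor_rel_refl add.assoc)
  show "x + y = y + x" by transfer (simp add: tensor_rel_refl add.commute)
  show "0 + x = x" by transfer (simp add: tensor_rel_refl)
  show "- x + x = 0" by transfer (simp add: tensor_rel_refl)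
  show "x - y = x + - y" by transfer (simp add: tensor_rel_refl)
  show "a *\<^sub>C (x + y) = a *\<^sub>C x + a *\<^sub>C y" by transfer (simp add: tensor_rel_refl scaleC_add_right)
  show "(a + b) *\<^sub>C x = a *\<^sub>C x + b *\<^sub>C x" by transfer (simp add: tensor_rel_refl scaleC_add_left)
  show "a *\<^sub>C (b *\<^sub>C x) = (a * b) *\<^sub>C x" by transfer (simp add: tensor_rel_refl scaleC_scaleC)
  show "1 *\<^sub>C x = x" by transfer (simp add: tensor_rel_refl scaleC_one)
qed
end

lift_definition tensor :: "'a::complex_vector \<Rightarrow> 'b::complex_vector \<Rightarrow> ('a, 'b) tensor" (infixr "\<otimes>" 70)
  is fpair .

lemma tensor_add_left: "(v + v') \<otimes> w = v \<otimes> w + v' \<otimes> w"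
proof transfer
  fix v v' :: 'a and w :: 'b
  have "fpair (v + v') w - fpair v w - fpair v' w \<in> tensor_relations"
    unfolding tensor_relations_def by (rule cvs.span_base) blast
  then show "tensor_rel (fpair (v + v') w) (fpair v w + fpair v' w)"
    by (simp add: tensor_rel_def diff_diff_add)
qed

lemma tensor_add_right: "v \<otimes> (w + w') = v \<otimes> w + v \<otimes> w'"
proof transfer
  fix v :: 'a and w w' :: 'b
  have "fpair v (w + w') - fpair v w - fpair v w' \<in> tensor_relations"
    unfolding tensor_relations_def by (rule cvs.span_base) blast
  then show "tensor_rel (fpair v (w + w')) (fpair v w + fpair v w')"
    by (simp add: tensor_rel_def diff_diff_add)
qed

lemma tensor_scaleC_left: "(c *\<^sub>C v) \<otimes> w = c *\<^sub>C (v \<otimes> w)"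
proof transfer
  fix c and v :: 'a and w :: 'b
  show "tensor_rel (fpair (c *\<^sub>C v) w) (c *\<^sub>C fpair v w)"
    unfolding tensor_rel_def tensor_relations_def by (rule cvs.span_base) blast
qed

lemma tensor_scaleC_right: "v \<otimes> (c *\<^sub>C w) = c *\<^sub>C (v \<otimes> w)"
proof transfer
  fix c and v :: 'a and w :: 'b
  show "tensor_rel (fpair v (c *\<^sub>C w)) (c *\<^sub>C fpair v w)"
    unfolding tensor_rel_def tensor_relations_def by (rule cvs.span_base) blast
qed

text \<open>For subspaces \<open>V\<close> and \<open>W\<close> of ambient spaces, \<open>V \<otimes> W\<close> is realized as a subspace of the tensor
  product of the ambient spaces. The two lemmas after the definition show that it has the universal
  property of the tensor product of \<open>V\<close> and \<open>W\<close> themselves.\<close>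

definition tensor_space ::
    "'a::complex_vector set \<Rightarrow> 'b::complex_vector set \<Rightarrow> ('a, 'b) tensor set" where
  "tensor_space V W = cvs.span {v \<otimes> w | v w. v \<in> V \<and> w \<in> W}"

definition free_lift ::
    "('a::complex_vector \<Rightarrow> 'b::complex_vector \<Rightarrow> 'c::complex_vector) \<Rightarrow> ('a \<times> 'b \<Rightarrow>\<^sub>0 complex) \<Rightarrow> 'c" where
  "free_lift \<phi> f = (\<Sum>k\<in>Poly_Mapping.keys f. Poly_Mapping.lookup f k *\<^sub>C \<phi> (fst k) (snd k))"

lemma free_lift_superset:
  assumes "finite A" "Poly_Mapping.keys f \<subseteq> A"
  shows "free_lift \<phi> f = (\<Sum>k\<in>A. Poly_Mapping.lookup f k *\<^sub>C \<phi> (fst k) (snd k))"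
  unfolding free_lift_def
  by (rule sum.mono_neutral_left[OF assms]) (simp add: in_keys_iff)

lemma free_lift_fpair: "free_lift \<phi> (fpair v w) = \<phi> v w"
  by (simp add: free_lift_def scaleC_one)

lemma free_lift_linear: "Vector_Spaces.linear scaleC scaleC (free_lift \<phi>)"
proof (rule Vector_Spaces.linear.intro)
  show "module_hom scaleC scaleC (free_lift \<phi>)"
  proof (intro module_hom.intro module_hom_axioms.intro cvs.module_axioms)
    fix f g :: "'a \<times> 'b \<Rightarrow>\<^sub>0 complex" and c
    let ?A = "Poly_Mapping.keys f \<union> Poly_Mapping.keys g"
    have "free_lift \<phi> (f + g) = (\<Sum>k\<in>?A. Poly_Mapping.lookup (f + g) k *\<^sub>C \<phi> (fst k) (snd k))"
      by (rule free_lift_superset) (auto simp: keys_add Poly_Mapping.keys_add[THEN subsetD])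
    also have "\<dots> = free_lift \<phi> f + free_lift \<phi> g"
      by (simp add: free_lift_superset[of ?A] lookup_add scaleC_add_left sum.distrib)
    finally show "free_lift \<phi> (f + g) = free_lift \<phi> f + free_lift \<phi> g" .
    have "free_lift \<phi> (c *\<^sub>C f) =
        (\<Sum>k\<in>Poly_Mapping.keys f. Poly_Mapping.lookup (c *\<^sub>C f) k *\<^sub>C \<phi> (fst k) (snd k))"
      by (rule free_lift_superset) (auto simp: in_keys_iff lookup_scaleC)
    also have "\<dots> = c *\<^sub>C free_lift \<phi> f"
      by (simp add: free_lift_def lookup_scaleC scaleC_complex_def cvs.scale_sum_right scaleC_scaleC)
    finally show "free_lift \<phi> (c *\<^sub>C f) = c *\<^sub>C free_lift \<phi> f" .
  qed
qed (rule cvs.vector_space_axioms)+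

lemma tensor_space_universal:
  fixes V :: "'a::complex_vector set" and W :: "'b::complex_vector set"
    and \<phi> :: "'a \<Rightarrow> 'b \<Rightarrow> 'c::complex_vector"
  assumes V: "cvs.subspace V" and W: "cvs.subspace W"
    and addl: "\<And>v v' w. \<lbrakk>v \<in> V; v' \<in> V; w \<in> W\<rbrakk> \<Longrightarrow> \<phi> (v + v') w = \<phi> v w + \<phi> v' w"
    and addr: "\<And>v w w'. \<lbrakk>v \<in> V; w \<in> W; w' \<in> W\<rbrakk> \<Longrightarrow> \<phi> v (w + w') = \<phi> v w + \<phi> v w'"
    and scl: "\<And>c v w. \<lbrakk>v \<in> V; w \<in> W\<rbrakk> \<Longrightarrow> \<phi> (c *\<^sub>C v) w = c *\<^sub>C \<phi> v w"
    and scr: "\<And>c v w. \<lbrakk>v \<in> V; w \<in> W\<rbrakk> \<Longrightarrow> \<phi> v (c *\<^sub>C w) = c *\<^sub>C \<phi> v w"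
  shows "\<exists>\<psi>. Vector_Spaces.linear scaleC scaleC \<psi> \<and> (\<forall>v\<in>V. \<forall>w\<in>W. \<psi> (v \<otimes> w) = \<phi> v w)"
proof -
  interpret pa: vector_space_pair "scaleC :: complex \<Rightarrow> 'a \<Rightarrow> 'a" "scaleC :: complex \<Rightarrow> 'a \<Rightarrow> 'a"
    by (intro vector_space_pair.intro cvs.vector_space_axioms)
  interpret pb: vector_space_pair "scaleC :: complex \<Rightarrow> 'b \<Rightarrow> 'b" "scaleC :: complex \<Rightarrow> 'b \<Rightarrow> 'b"
    by (intro vector_space_pair.intro cvs.vector_space_axioms)
  obtain P where P: "range P \<subseteq> V" "Vector_Spaces.linear scaleC scaleC P" "\<forall>v\<in>V. P v = v"
    using pa.linear_exists_left_inverse_on[OF cvs.linear_ident V] by auto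
  obtain Q where Q: "range Q \<subseteq> W" "Vector_Spaces.linear scaleC scaleC Q" "\<forall>w\<in>W. Q w = w"
    using pb.linear_exists_left_inverse_on[OF cvs.linear_ident W] by auto
  interpret P: Vector_Spaces.linear scaleC scaleC P by (rule P(2))
  interpret Q: Vector_Spaces.linear scaleC scaleC Q by (rule Q(2))
  have PV: "P v \<in> V" and QW: "Q w \<in> W" for v w using P(1) Q(1) by auto
  define L where "L = free_lift (\<lambda>v w. \<phi> (P v) (Q w))"
  interpret L: Vector_Spaces.linear scaleC scaleC L unfolding L_def by (rule free_lift_linear)
  have Lp: "L (fpair v w) = \<phi> (P v) (Q w)" for v w
    by (simp add: L_def free_lift_fpair)
  have L0: "L f = 0" if "f \<in> tensor_relations" for f
    by (rule L.eq_0_on_span[OF _ that[unfolded tensor_relations_def]])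
      (auto simp: L.diff L.scale Lp P.add Q.add P.scale Q.scale addl addr scl scr PV QW)
  define \<psi> where "\<psi> t = L (rep_tensor t)" for t
  have \<psi>: "\<psi> (abs_tensor f) = L f" for f
  proof -
    have "tensor_rel (rep_tensor (abs_tensor f)) f"
      by (metis Quotient3_tensor Quotient3_rep_abs tensor_rel_refl)
    then have "L (rep_tensor (abs_tensor f) - f) = 0" by (simp add: tensor_rel_def L0)
    then show ?thesis by (simp add: \<psi>_def L.diff)
  qed
  have ex: "\<exists>f. t = abs_tensor f" for t :: "('a, 'b) tensor"
    by (metis Quotient3_tensor Quotient3_abs_rep)
  have "Vector_Spaces.linear scaleC scaleC \<psi>"
  proof (rule Vector_Spaces.linear.intro)
    show "module_hom scaleC scaleC \<psi>"
    proof (intro module_hom.intro module_hom_axioms.intro cvs.module_axioms)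
      fix s t :: "('a, 'b) tensor" and c
      obtain f g where "s = abs_tensor f" "t = abs_tensor g" using ex by metis
      then show "\<psi> (s + t) = \<psi> s + \<psi> t" "\<psi> (c *\<^sub>C s) = c *\<^sub>C \<psi> s"
        by (simp_all add: plus_tensor.abs_eq scaleC_tensor.abs_eq \<psi> L.add L.scale)
    qed
  qed (rule cvs.vector_space_axioms)+
  moreover have "\<psi> (v \<otimes> w) = \<phi> v w" if "v \<in> V" "w \<in> W" for v w
    using that P(3) Q(3) by (simp add: tensor.abs_eq \<psi> Lp)
  ultimately show ?thesis by blast
qed

lemma tensor_space_unique:
  fixes \<psi> \<psi>' :: "('a::complex_vector, 'b::complex_vector) tensor \<Rightarrow> 'c::complex_vector"
  assumes "Vector_Spaces.linear scaleC scaleC \<psi>" "Vector_Spaces.linear scaleC scaleC \<psi>'"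
    and "\<forall>v\<in>V. \<forall>w\<in>W. \<psi> (v \<otimes> w) = \<psi>' (v \<otimes> w)" and "t \<in> tensor_space V W"
  shows "\<psi> t = \<psi>' t"
proof -
  interpret vector_space_pair
    "scaleC :: complex \<Rightarrow> ('a, 'b) tensor \<Rightarrow> ('a, 'b) tensor" "scaleC :: complex \<Rightarrow> 'c \<Rightarrow> 'c"
    by (intro vector_space_pair.intro cvs.vector_space_axioms)
  show ?thesis
    by (rule linear_eq_on[OF assms(1,2) assms(4)[unfolded tensor_space_def]]) (use assms(3) in auto)
qed


section \<open>The schur tensor product\<close>

text \<open>The \<open>(i, j)\<close> entry of \<open>\<alpha>(x \<circ> y)\<beta>\<close> is the sum over \<open>k\<close> and \<open>l\<close> below.\<close>

definition schur_norm ::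
    "('h::chilbert_space \<Rightarrow>\<^sub>L 'h) set \<Rightarrow> ('k::chilbert_space \<Rightarrow>\<^sub>L 'k) set \<Rightarrow>
     nat \<Rightarrow> (nat \<Rightarrow> nat \<Rightarrow> ('h \<Rightarrow>\<^sub>L 'h, 'k \<Rightarrow>\<^sub>L 'k) tensor) \<Rightarrow> real" where
  "schur_norm V W p u =
     Inf {scalar_mat_norm p n \<alpha> * op_mat_norm n x * op_mat_norm n y * scalar_mat_norm n p \<beta>
          | n \<alpha> x y \<beta>. n \<ge> 1 \<and> x \<in> mats n V \<and> y \<in> mats n W \<and>
              (\<forall>i<p. \<forall>j<p. u i j = (\<Sum>k<n. \<Sum>l<n. (\<alpha> i k * \<beta> l j) *\<^sub>C (x k l \<otimes> y k l)))}"

text \<open>Completion of a subspace with matrix norms \<open>\<nu>\<close>: Cauchy sequences modulo null sequences, both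
  for \<open>\<nu> 1\<close>. The norm of a matrix of classes is the limit of the norms along representing
  sequences.\<close>

definition cauchy_seqs ::
    "'t::complex_vector set \<Rightarrow> (nat \<Rightarrow> (nat \<Rightarrow> nat \<Rightarrow> 't) \<Rightarrow> real) \<Rightarrow> (nat \<Rightarrow> 't) set" where
  "cauchy_seqs T \<nu> =
     {s. range s \<subseteq> T \<and> (\<forall>e>0. \<exists>N. \<forall>k\<ge>N. \<forall>l\<ge>N. \<nu> 1 (\<lambda>_ _. s k - s l) < e)}"

definition null_rel ::
    "'t::complex_vector set \<Rightarrow> (nat \<Rightarrow> (nat \<Rightarrow> nat \<Rightarrow> 't) \<Rightarrow> real) \<Rightarrow> ((nat \<Rightarrow> 't) \<times> (nat \<Rightarrow> 't)) set" where
  "null_rel T \<nu> =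
     {(s, t). s \<in> cauchy_seqs T \<nu> \<and> t \<in> cauchy_seqs T \<nu> \<and> (\<lambda>k. \<nu> 1 (\<lambda>_ _. s k - t k)) \<longlonglongrightarrow> 0}"

definition completion ::
    "'t::complex_vector set \<Rightarrow> (nat \<Rightarrow> (nat \<Rightarrow> nat \<Rightarrow> 't) \<Rightarrow> real) \<Rightarrow> (nat \<Rightarrow> 't) set matricial_space" where
  "completion T \<nu> =
     \<lparr>pts = cauchy_seqs T \<nu> // null_rel T \<nu>,
      add = (\<lambda>A B. \<Union>s\<in>A. \<Union>t\<in>B. null_rel T \<nu> `` {\<lambda>k. s k + t k}),
      scl = (\<lambda>c A. \<Union>s\<in>A. null_rel T \<nu> `` {\<lambda>k. c *\<^sub>C s k}),
      mnorm = (\<lambda>n a. lim (\<lambda>k. \<nu> n (\<lambda>i j. (SOME s. s \<in> a i j) k)))\<rparr>"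

definition schur_tensor ::
    "('h::chilbert_space \<Rightarrow>\<^sub>L 'h) set \<Rightarrow> ('k::chilbert_space \<Rightarrow>\<^sub>L 'k) set \<Rightarrow>
     (nat \<Rightarrow> ('h \<Rightarrow>\<^sub>L 'h, 'k \<Rightarrow>\<^sub>L 'k) tensor) set matricial_space" (infixr "\<otimes>\<^sup>s" 70) where
  "V \<otimes>\<^sup>s W = completion (tensor_space V W) (schur_norm V W)"

text \<open>The image of \<open>u \<in> V \<otimes> W\<close> in the completion, represented by a constant sequence.\<close>

definition schur_incl ::
    "('h::chilbert_space \<Rightarrow>\<^sub>L 'h) set \<Rightarrow> ('k::chilbert_space \<Rightarrow>\<^sub>L 'k) set \<Rightarrow>
     ('h \<Rightarrow>\<^sub>L 'h, 'k \<Rightarrow>\<^sub>L 'k) tensor \<Rightarrow> (nat \<Rightarrow> ('h \<Rightarrow>\<^sub>L 'h, 'k \<Rightarrow>\<^sub>L 'k) tensor) set" where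
  "schur_incl V W u = null_rel (tensor_space V W) (schur_norm V W) `` {\<lambda>_. u}"

definition assoc_bilinear ::
    "('h::chilbert_space \<Rightarrow>\<^sub>L 'h) set \<Rightarrow> ('k::chilbert_space \<Rightarrow>\<^sub>L 'k) set \<Rightarrow>
     ((nat \<Rightarrow> ('h \<Rightarrow>\<^sub>L 'h, 'k \<Rightarrow>\<^sub>L 'k) tensor) set \<Rightarrow> 'x) \<Rightarrow>
     ('h \<Rightarrow>\<^sub>L 'h) \<times> ('k \<Rightarrow>\<^sub>L 'k) \<Rightarrow> 'x" where
  "assoc_bilinear V W \<psi> = (\<lambda>(v, w)\<in>V \<times> W. \<psi> (schur_incl V W (v \<otimes> w)))"

end

theory Submission
  imports Defs
begin

text \<open>
  A schur bounded bilinear map \<open>\<phi>\<close> linearizes to a map \<open>L\<close> on the algebraic tensor product, and \<open>L\<close>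
  sends \<open>\<alpha>(x \<circ> y)\<beta>\<close> to \<open>\<alpha> \<phi>\<^sub>n(x, y) \<beta>\<close>. In matrices of operators, multiplication by scalar matrices
  from the left and the right costs at most \<open>\<parallel>\<alpha>\<parallel> \<parallel>\<beta>\<parallel>\<close>, so \<open>L\<close> satisfies
  \<open>\<parallel>L\<^sub>p(u)\<parallel> \<le> \<parallel>\<phi>\<parallel>\<^sub>s\<^sub>b \<parallel>u\<parallel>\<^sub>s\<close> (\<open>linear_bound_of_schur_bound\<close>) and extends to the completion with the same
  bound (\<open>SB_extension\<close>). Conversely \<open>\<parallel>x \<circ> y\<parallel>\<^sub>s \<le> \<parallel>x\<parallel> \<parallel>y\<parallel>\<close>, by taking \<open>\<alpha> = \<beta> = 1\<close>, so restricting a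
  completely bounded map to elementary tensors gives a schur bounded bilinear map of no larger norm
  (\<open>assoc_bilinear_in_SB\<close>, \<open>sb_norm_le_cb_norm\<close>). A completely bounded map is determined by this
  restriction, since elementary tensors span a dense subspace (\<open>assoc_bilinear_inj\<close>). Hence the two
  constructions are inverse to each other, and both are contractive.

  Two points need work. The scalar matrices act on sums of copies of an arbitrary Hilbert
  space, while their norm is computed on sums of copies of \<open>\<complex>\<close>; expanding vectors in an orthonormal
  family reduces the former to the latter (\<open>scalar_mat_apply_Hilbert\<close>). And the
  completion is well behaved only if the schur norms satisfy the triangle inequality and are
  controlled by the norms of the entries (\<open>schur_norm_matrix_seminorm\<close>). For the triangle inequality a
  decomposition is rescaled so that \<open>x\<close> and \<open>y\<close> lie in the unit balls and \<open>\<parallel>\<alpha>\<parallel>\<^sup>2\<close> and \<open>\<parallel>\<beta>\<parallel>\<^sup>2\<close> have a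
  common bound \<open>c\<close>; with decompositions in this form put into block matrices, the bounds \<open>c\<close> add up
  (\<open>balanced_decomp_add\<close>).
\<close>

section \<open>Operator norms of matrices\<close>

lemma sum_lessThan_add:
  fixes f :: "nat \<Rightarrow> 'a::comm_monoid_add"
  shows "(\<Sum>k<m + n. f k) = (\<Sum>k<m. f k) + (\<Sum>k<n. f (m + k))"
  by (induction n) (simp_all add: add.assoc)

lemma L2_set_le_iff_sum_squares:
  assumes "0 \<le> C"
  shows "L2_set f A \<le> C \<longleftrightarrow> (\<Sum>i\<in>A. (f i)\<^sup>2) \<le> C\<^sup>2"
  using assms by (metis L2_set_def L2_set_nonneg real_sqrt_le_iff real_sqrt_unique)

lemma L2_set_squared: "(L2_set f A)\<^sup>2 = (\<Sum>i\<in>A. (f i)\<^sup>2)"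
  by (simp add: L2_set_def sum_nonneg)

lemma L2_set_norm_divideR:
  assumes "0 < t"
  shows "L2_set (\<lambda>i. norm (f i /\<^sub>R t)) S = L2_set (\<lambda>i. norm (f i)) S / t"
  using assms L2_set_right_distrib[of "inverse t" "\<lambda>i. norm (f i)" S]
  by (simp add: divide_inverse mult.commute)

lemma mat_opnorm_bdd_above:
  fixes act :: "'e::real_normed_vector \<Rightarrow> 'a::real_normed_vector \<Rightarrow> 'b::real_normed_vector"
  assumes "bounded_bilinear act"
  shows "bdd_above ((\<lambda>\<xi>. L2_set (\<lambda>i. norm (\<Sum>j<n. act (x i j) (\<xi> j))) {..<p}) `
           {\<xi> :: nat \<Rightarrow> 'a. L2_set (\<lambda>j. norm (\<xi> j)) {..<n} \<le> 1})"
    (is "bdd_above (?f ` ?S)")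
proof -
  interpret bounded_bilinear act by fact
  obtain K where K: "\<And>e v. norm (act e v) \<le> norm e * norm v * K" and "0 \<le> K"
    using nonneg_bounded by blast
  have "?f \<xi> \<le> (\<Sum>i<p. \<Sum>j<n. norm (x i j) * K)" if "\<xi> \<in> ?S" for \<xi>
  proof -
    have le1: "norm (\<xi> j) \<le> 1" if "j < n" for j
      using member_le_L2_set[of "{..<n}" j "\<lambda>j. norm (\<xi> j)"] that \<open>\<xi> \<in> ?S\<close> by auto
    have "?f \<xi> \<le> (\<Sum>i<p. norm (\<Sum>j<n. act (x i j) (\<xi> j)))"
      by (rule L2_set_le_sum) simp
    also have "\<dots> \<le> (\<Sum>i<p. \<Sum>j<n. norm (x i j) * K)"
    proof (intro sum_mono order_trans[OF norm_sum])
      fix i j assume "j \<in> {..<n}"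
      then have "norm (x i j) * norm (\<xi> j) * K \<le> norm (x i j) * 1 * K"
        using le1 \<open>0 \<le> K\<close> by (intro mult_right_mono mult_left_mono) auto
      with K[of "x i j" "\<xi> j"] show "norm (act (x i j) (\<xi> j)) \<le> norm (x i j) * K" by simp
    qed
    finally show ?thesis .
  qed
  then show ?thesis by (intro bdd_aboveI) blast
qed

lemma mat_opnorm_nonneg:
  fixes act :: "'e::real_normed_vector \<Rightarrow> 'a::real_normed_vector \<Rightarrow> 'b::real_normed_vector"
  assumes "bounded_bilinear act"
  shows "0 \<le> mat_opnorm act p n x"
  unfolding mat_opnorm_def
  by (rule cSUP_upper2[OF mat_opnorm_bdd_above[OF assms], of "\<lambda>_. 0"]) (simp_all add: L2_set_def sum_nonneg)

text \<open>Upper bounds for operator norms are proved in this form: for vectors \<open>\<xi>\<close> of arbitrary length,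
  with both sides squared, so that sums over blocks can be split off.\<close>

lemma mat_opnorm_leI:
  fixes act :: "'e \<Rightarrow> 'a::real_normed_vector \<Rightarrow> 'b::real_normed_vector"
  assumes "0 \<le> C"
    and "\<And>\<xi>. (\<Sum>i<p. (norm (\<Sum>j<n. act (x i j) (\<xi> j)))\<^sup>2) \<le> C\<^sup>2 * (\<Sum>j<n. (norm (\<xi> j))\<^sup>2)"
  shows "mat_opnorm act p n x \<le> C"
  unfolding mat_opnorm_def
proof (rule cSUP_least)
  show "{\<xi>. L2_set (\<lambda>j. norm (\<xi> j)) {..<n} \<le> 1} \<noteq> {}"
    by (auto simp: L2_set_def intro!: exI[of _ "\<lambda>_. 0"])
  fix \<xi> :: "nat \<Rightarrow> 'a" assume "\<xi> \<in> {\<xi>. L2_set (\<lambda>j. norm (\<xi> j)) {..<n} \<le> 1}"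
  then have "(\<Sum>j<n. (norm (\<xi> j))\<^sup>2) \<le> 1"
    using L2_set_le_iff_sum_squares[of 1 "\<lambda>j. norm (\<xi> j)" "{..<n}"] by simp
  then have "C\<^sup>2 * (\<Sum>j<n. (norm (\<xi> j))\<^sup>2) \<le> C\<^sup>2"
    using mult_left_mono[of _ 1 "C\<^sup>2"] by fastforce
  with assms(2)[of \<xi>] show "L2_set (\<lambda>i. norm (\<Sum>j<n. act (x i j) (\<xi> j))) {..<p} \<le> C"
    using L2_set_le_iff_sum_squares[OF assms(1), of "\<lambda>i. norm (\<Sum>j<n. act (x i j) (\<xi> j))"]
    by simp
qed

lemma mat_opnorm_apply:
  fixes act :: "'e::real_normed_vector \<Rightarrow> 'a::real_normed_vector \<Rightarrow> 'b::real_normed_vector"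
  assumes "bounded_bilinear act"
  shows "L2_set (\<lambda>i. norm (\<Sum>j<n. act (x i j) (\<xi> j))) {..<p} \<le>
           mat_opnorm act p n x * L2_set (\<lambda>j. norm (\<xi> j)) {..<n}"
proof (cases "L2_set (\<lambda>j. norm (\<xi> j)) {..<n} = 0")
  case True
  interpret bounded_bilinear act by fact
  from True have "\<xi> j = 0" if "j < n" for j
    using that by (simp add: L2_set_eq_0_iff)
  then show ?thesis by (simp add: zero_right L2_set_def)
next
  case False
  interpret bounded_bilinear act by fact
  define t where "t = L2_set (\<lambda>j. norm (\<xi> j)) {..<n}"
  have t: "t > 0" using False by (simp add: t_def order.not_eq_order_implies_strict)
  note sc = L2_set_norm_divideR[OF t]
  have "L2_set (\<lambda>i. norm (\<Sum>j<n. act (x i j) (\<xi> j /\<^sub>R t))) {..<p} \<le> mat_opnorm act p n x"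
    unfolding mat_opnorm_def
    by (rule cSUP_upper[OF _ mat_opnorm_bdd_above[OF assms]]) (use t in \<open>simp add: sc t_def[symmetric] del: norm_scaleR\<close>)
  moreover have "(\<Sum>j<n. act (x i j) (\<xi> j /\<^sub>R t)) = (\<Sum>j<n. act (x i j) (\<xi> j)) /\<^sub>R t" for i
    by (simp add: scaleR_right scaleR_right.sum scaleR_sum_right)
  ultimately have "L2_set (\<lambda>i. norm (\<Sum>j<n. act (x i j) (\<xi> j))) {..<p} / t \<le> mat_opnorm act p n x"
    by (simp only: sc)
  then show ?thesis using t by (simp add: t_def[symmetric] field_simps)
qed

lemma mat_opnorm_apply_squared:
  fixes act :: "'e::real_normed_vector \<Rightarrow> 'a::real_normed_vector \<Rightarrow> 'b::real_normed_vector"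
  assumes "bounded_bilinear act"
  shows "(\<Sum>i<p. (norm (\<Sum>j<n. act (x i j) (\<xi> j)))\<^sup>2) \<le>
           (mat_opnorm act p n x)\<^sup>2 * (\<Sum>j<n. (norm (\<xi> j))\<^sup>2)"
  using power_mono[OF mat_opnorm_apply[OF assms, where x=x and \<xi>=\<xi> and n=n and p=p] L2_set_nonneg, of 2]
  by (simp add: power_mult_distrib L2_set_squared)

lemma mat_opnorm_cong:
  assumes "\<And>i j. i < p \<Longrightarrow> j < n \<Longrightarrow> x i j = y i j"
  shows "mat_opnorm act p n x = mat_opnorm act p n y"
proof -
  have "(\<Sum>j<n. act (x i j) (\<xi> j)) = (\<Sum>j<n. act (y i j) (\<xi> j))" if "i < p" for i \<xi>
    using assms that by (intro sum.cong) auto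
  then have "L2_set (\<lambda>i. norm (\<Sum>j<n. act (x i j) (\<xi> j))) {..<p} =
      L2_set (\<lambda>i. norm (\<Sum>j<n. act (y i j) (\<xi> j))) {..<p}" for \<xi>
    by (intro L2_set_cong) auto
  then show ?thesis unfolding mat_opnorm_def by simp
qed

lemma mat_opnorm_add:
  fixes act :: "'e::real_normed_vector \<Rightarrow> 'a::real_normed_vector \<Rightarrow> 'b::real_normed_vector"
  assumes "bounded_bilinear act"
  shows "mat_opnorm act p n (\<lambda>i j. x i j + y i j) \<le> mat_opnorm act p n x + mat_opnorm act p n y"
proof (rule mat_opnorm_leI)
  interpret bounded_bilinear act by fact
  show "0 \<le> mat_opnorm act p n x + mat_opnorm act p n y"
    using mat_opnorm_nonneg[OF assms] by (intro add_nonneg_nonneg)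
  fix \<xi> :: "nat \<Rightarrow> 'a"
  let ?t = "L2_set (\<lambda>j. norm (\<xi> j)) {..<n}"
  have "L2_set (\<lambda>i. norm (\<Sum>j<n. act (x i j + y i j) (\<xi> j))) {..<p} \<le>
      L2_set (\<lambda>i. norm (\<Sum>j<n. act (x i j) (\<xi> j)) + norm (\<Sum>j<n. act (y i j) (\<xi> j))) {..<p}"
    by (rule L2_set_mono) (simp_all add: add_left sum.distrib norm_triangle_ineq)
  also have "\<dots> \<le> mat_opnorm act p n x * ?t + mat_opnorm act p n y * ?t"
    by (rule order_trans[OF L2_set_triangle_ineq add_mono]; rule mat_opnorm_apply[OF assms])
  finally have "L2_set (\<lambda>i. norm (\<Sum>j<n. act (x i j + y i j) (\<xi> j))) {..<p} \<le>
      (mat_opnorm act p n x + mat_opnorm act p n y) * ?t" by (simp add: distrib_right)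
  from power_mono[OF this L2_set_nonneg, of 2]
  show "(\<Sum>i<p. (norm (\<Sum>j<n. act (x i j + y i j) (\<xi> j)))\<^sup>2) \<le>
      (mat_opnorm act p n x + mat_opnorm act p n y)\<^sup>2 * (\<Sum>j<n. (norm (\<xi> j))\<^sup>2)"
    by (simp add: power_mult_distrib L2_set_squared)
qed

lemma mat_opnorm_scale:
  fixes act :: "'e::real_normed_vector \<Rightarrow> 'a::real_normed_vector \<Rightarrow> 'b::complex_normed_vector"
  assumes "bounded_bilinear act" and "\<And>e v. act (g e) v = c *\<^sub>C act e v"
  shows "mat_opnorm act p n (\<lambda>i j. g (x i j)) \<le> cmod c * mat_opnorm act p n x"
proof (rule mat_opnorm_leI)
  show "0 \<le> cmod c * mat_opnorm act p n x" using mat_opnorm_nonneg[OF assms(1)] by simp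
  fix \<xi> :: "nat \<Rightarrow> 'a"
  have "(\<Sum>i<p. (norm (\<Sum>j<n. act (g (x i j)) (\<xi> j)))\<^sup>2) =
      (cmod c)\<^sup>2 * (\<Sum>i<p. (norm (\<Sum>j<n. act (x i j) (\<xi> j)))\<^sup>2)"
    by (simp add: assms(2) cvs.scale_sum_right[symmetric] norm_scaleC power_mult_distrib
        sum_distrib_left)
  also have "\<dots> \<le> (cmod c)\<^sup>2 * ((mat_opnorm act p n x)\<^sup>2 * (\<Sum>j<n. (norm (\<xi> j))\<^sup>2))"
    by (rule mult_left_mono[OF mat_opnorm_apply_squared[OF assms(1)]]) simp
  finally show "(\<Sum>i<p. (norm (\<Sum>j<n. act (g (x i j)) (\<xi> j)))\<^sup>2) \<le>
      (cmod c * mat_opnorm act p n x)\<^sup>2 * (\<Sum>j<n. (norm (\<xi> j))\<^sup>2)"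
    by (simp add: power_mult_distrib mult.assoc)
qed

lemmas scalar_mat_norm_nonneg = mat_opnorm_nonneg[OF bounded_bilinear_mult]
lemmas scalar_mat_norm_apply_squared = mat_opnorm_apply_squared[OF bounded_bilinear_mult]
lemmas op_mat_norm_nonneg = mat_opnorm_nonneg[OF bounded_bilinear_blinfun_apply]
lemmas op_mat_norm_apply_squared = mat_opnorm_apply_squared[OF bounded_bilinear_blinfun_apply]
lemmas op_mat_norm_add = mat_opnorm_add[OF bounded_bilinear_blinfun_apply]

lemma scalar_mat_norm_scale:
  "scalar_mat_norm p n (\<lambda>i j. c * \<alpha> i j) \<le> cmod c * scalar_mat_norm p n \<alpha>"
  by (rule mat_opnorm_scale[OF bounded_bilinear_mult]) (simp add: scaleC_complex_def)

lemma op_mat_norm_scale: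
  "op_mat_norm n (\<lambda>i j. c *\<^sub>C x i j) \<le> cmod c * op_mat_norm n x"
  by (rule mat_opnorm_scale[OF bounded_bilinear_blinfun_apply]) (simp add: scaleC_blinfun.rep_eq)

lemma op_mat_norm_le_sum: "op_mat_norm n x \<le> (\<Sum>i<n. \<Sum>j<n. norm (x i j))"
proof (rule mat_opnorm_leI)
  show "0 \<le> (\<Sum>i<n. \<Sum>j<n. norm (x i j))" by (intro sum_nonneg) simp
  fix \<xi> :: "nat \<Rightarrow> 'a"
  let ?t = "L2_set (\<lambda>j. norm (\<xi> j)) {..<n}"
  have "L2_set (\<lambda>i. norm (\<Sum>j<n. blinfun_apply (x i j) (\<xi> j))) {..<n} \<le>
      (\<Sum>i<n. norm (\<Sum>j<n. blinfun_apply (x i j) (\<xi> j)))"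
    by (rule L2_set_le_sum) simp
  also have "\<dots> \<le> (\<Sum>i<n. \<Sum>j<n. norm (x i j) * ?t)"
  proof (intro sum_mono order_trans[OF norm_sum])
    fix i j assume "j \<in> {..<n}"
    then show "norm (blinfun_apply (x i j) (\<xi> j)) \<le> norm (x i j) * ?t"
      by (intro order_trans[OF norm_blinfun mult_left_mono] member_le_L2_set) auto
  qed
  also have "\<dots> = (\<Sum>i<n. \<Sum>j<n. norm (x i j)) * ?t"
    by (simp add: sum_distrib_right)
  finally have "L2_set (\<lambda>i. norm (\<Sum>j<n. blinfun_apply (x i j) (\<xi> j))) {..<n} \<le> \<dots>" .
  from power_mono[OF this L2_set_nonneg, of 2]
  show "(\<Sum>i<n. (norm (\<Sum>j<n. blinfun_apply (x i j) (\<xi> j)))\<^sup>2) \<le>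
      (\<Sum>i<n. \<Sum>j<n. norm (x i j))\<^sup>2 * (\<Sum>j<n. (norm (\<xi> j))\<^sup>2)"
    by (simp add: power_mult_distrib L2_set_squared)
qed

lemma norm_le_op_mat_norm: "norm T \<le> op_mat_norm 1 (\<lambda>_ _. T)"
proof (rule norm_blinfun_bound[OF op_mat_norm_nonneg])
  show "norm (blinfun_apply T \<xi>) \<le> op_mat_norm 1 (\<lambda>_ _. T) * norm \<xi>" for \<xi>
    using mat_opnorm_apply[OF bounded_bilinear_blinfun_apply, where x="\<lambda>_ _. T" and \<xi>="\<lambda>_. \<xi>" and n=1 and p=1]
    by (simp add: L2_set_def lessThan_Suc)
qed

text \<open>By the Cauchy--Schwarz inequality in \<open>\<real>\<^sup>2\<close>: a vector splits into two blocks of norms \<open>r\<close> and \<open>s\<close>,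
  and \<open>(\<surd>a r + \<surd>b s)\<^sup>2 \<le> (a + b)(r\<^sup>2 + s\<^sup>2)\<close>.\<close>

lemma scalar_mat_norm_append_columns:
  assumes "(scalar_mat_norm p m \<alpha>)\<^sup>2 \<le> a" and "(scalar_mat_norm p n \<beta>)\<^sup>2 \<le> b"
  shows "(scalar_mat_norm p (m + n) (\<lambda>i k. if k < m then \<alpha> i k else \<beta> i (k - m)))\<^sup>2 \<le> a + b"
proof -
  have ab: "0 \<le> a" "0 \<le> b" using assms by (meson order_trans zero_le_power2)+
  have "scalar_mat_norm p (m + n) (\<lambda>i k. if k < m then \<alpha> i k else \<beta> i (k - m)) \<le> sqrt (a + b)"
  proof (rule mat_opnorm_leI)
    fix \<xi> :: "nat \<Rightarrow> complex"
    let ?X = "\<Sum>j<m. (cmod (\<xi> j))\<^sup>2" and ?Y = "\<Sum>j<n. (cmod (\<xi> (m + j)))\<^sup>2"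
    let ?f = "\<lambda>i. \<Sum>j<m. \<alpha> i j * \<xi> j" and ?g = "\<lambda>i. \<Sum>j<n. \<beta> i j * \<xi> (m + j)"
    have XY: "0 \<le> ?X" "0 \<le> ?Y" by (simp_all add: sum_nonneg)
    have f: "L2_set (\<lambda>i. cmod (?f i)) {..<p} \<le> sqrt (a * ?X)"
      unfolding L2_set_def real_sqrt_le_iff
      by (rule order_trans[OF scalar_mat_norm_apply_squared mult_right_mono[OF assms(1) XY(1)]])
    have g: "L2_set (\<lambda>i. cmod (?g i)) {..<p} \<le> sqrt (b * ?Y)"
      unfolding L2_set_def real_sqrt_le_iff
      by (rule order_trans[OF scalar_mat_norm_apply_squared mult_right_mono[OF assms(2) XY(2)]])
    have "L2_set (\<lambda>i. cmod (?f i + ?g i)) {..<p} \<le>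
        L2_set (\<lambda>i. cmod (?f i) + cmod (?g i)) {..<p}"
      by (intro L2_set_mono norm_triangle_ineq) simp_all
    also have "\<dots> \<le> sqrt (a * ?X) + sqrt (b * ?Y)"
      by (rule order_trans[OF L2_set_triangle_ineq add_mono[OF f g]])
    finally have "(L2_set (\<lambda>i. cmod (?f i + ?g i)) {..<p})\<^sup>2 \<le> (sqrt (a * ?X) + sqrt (b * ?Y))\<^sup>2"
      by (rule power_mono) simp
    also have "\<dots> = a * ?X + b * ?Y + 2 * (sqrt (a * ?Y) * sqrt (b * ?X))"
      using ab XY by (simp add: power2_sum real_sqrt_mult power_mult_distrib)
    also have "\<dots> \<le> a * ?X + b * ?Y + (a * ?Y + b * ?X)"
      using sum_squares_bound[of "sqrt (a * ?Y)" "sqrt (b * ?X)"] ab XY by simp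
    finally show "(\<Sum>i<p. (cmod (\<Sum>k<m + n. (if k < m then \<alpha> i k else \<beta> i (k - m)) * \<xi> k))\<^sup>2)
        \<le> (sqrt (a + b))\<^sup>2 * (\<Sum>j<m + n. (cmod (\<xi> j))\<^sup>2)"
      using ab by (simp add: L2_set_squared sum_lessThan_add algebra_simps)
  qed (use ab in simp)
  from power_mono[OF this scalar_mat_norm_nonneg, of 2] ab show ?thesis by simp
qed

text \<open>Both blocks act on the same vector and their values lie in orthogonal summands, so the squares
  add.\<close>

lemma scalar_mat_norm_append_rows:
  assumes "(scalar_mat_norm m p \<alpha>)\<^sup>2 \<le> a" and "(scalar_mat_norm n p \<beta>)\<^sup>2 \<le> b"
  shows "(scalar_mat_norm (m + n) p (\<lambda>l j. if l < m then \<alpha> l j else \<beta> (l - m) j))\<^sup>2 \<le> a + b"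
proof -
  have ab: "0 \<le> a" "0 \<le> b" using assms by (meson order_trans zero_le_power2)+
  have "scalar_mat_norm (m + n) p (\<lambda>l j. if l < m then \<alpha> l j else \<beta> (l - m) j) \<le> sqrt (a + b)"
  proof (rule mat_opnorm_leI)
    fix \<xi> :: "nat \<Rightarrow> complex"
    let ?X = "\<Sum>j<p. (cmod (\<xi> j))\<^sup>2"
    have X: "0 \<le> ?X" by (simp add: sum_nonneg)
    have "(\<Sum>i<m. (cmod (\<Sum>j<p. \<alpha> i j * \<xi> j))\<^sup>2) \<le> a * ?X"
      by (rule order_trans[OF scalar_mat_norm_apply_squared mult_right_mono[OF assms(1) X]])
    moreover have "(\<Sum>i<n. (cmod (\<Sum>j<p. \<beta> i j * \<xi> j))\<^sup>2) \<le> b * ?X"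
      by (rule order_trans[OF scalar_mat_norm_apply_squared mult_right_mono[OF assms(2) X]])
    ultimately show "(\<Sum>l<m + n. (cmod (\<Sum>j<p. (if l < m then \<alpha> l j else \<beta> (l - m) j) * \<xi> j))\<^sup>2)
        \<le> (sqrt (a + b))\<^sup>2 * ?X"
      using ab by (simp add: sum_lessThan_add algebra_simps)
  qed (use ab in simp)
  from power_mono[OF this scalar_mat_norm_nonneg, of 2] ab show ?thesis by simp
qed

definition direct_sum_mat ::
    "nat \<Rightarrow> (nat \<Rightarrow> nat \<Rightarrow> 'a::zero) \<Rightarrow> (nat \<Rightarrow> nat \<Rightarrow> 'a) \<Rightarrow> nat \<Rightarrow> nat \<Rightarrow> 'a" where
  "direct_sum_mat m x y k l =
     (if k < m then if l < m then x k l else 0 else if l < m then 0 else y (k - m) (l - m))"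

lemma direct_sum_mat_simps:
  "k < m \<Longrightarrow> l < m \<Longrightarrow> direct_sum_mat m x y k l = x k l"
  "k < m \<Longrightarrow> direct_sum_mat m x y k (m + l) = 0"
  "l < m \<Longrightarrow> direct_sum_mat m x y (m + k) l = 0"
  "direct_sum_mat m x y (m + k) (m + l) = y k l"
  by (simp_all add: direct_sum_mat_def)

lemma direct_sum_mat_mats:
  assumes "x \<in> mats m S" "y \<in> mats n S" "0 \<in> S"
  shows "direct_sum_mat m x y \<in> mats (m + n) S"
  using assms by (auto simp: mats_def direct_sum_mat_def)

lemma op_mat_norm_direct_sum_le_1:
  assumes "op_mat_norm m x \<le> 1" and "op_mat_norm n y \<le> 1"
  shows "op_mat_norm (m + n) (direct_sum_mat m x y) \<le> 1"
proof (rule mat_opnorm_leI)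
  fix \<xi> :: "nat \<Rightarrow> 'a"
  have x: "(op_mat_norm m x)\<^sup>2 \<le> 1" and y: "(op_mat_norm n y)\<^sup>2 \<le> 1"
    using assms by (simp_all add: power_le_one op_mat_norm_nonneg)
  have "(\<Sum>i<m. (norm (\<Sum>j<m. blinfun_apply (x i j) (\<xi> j)))\<^sup>2) \<le> 1 * (\<Sum>j<m. (norm (\<xi> j))\<^sup>2)"
    by (rule order_trans[OF op_mat_norm_apply_squared mult_right_mono[OF x]]) (simp add: sum_nonneg)
  moreover have "(\<Sum>i<n. (norm (\<Sum>j<n. blinfun_apply (y i j) (\<xi> (m + j))))\<^sup>2) \<le>
      1 * (\<Sum>j<n. (norm (\<xi> (m + j)))\<^sup>2)"
    by (rule order_trans[OF op_mat_norm_apply_squared mult_right_mono[OF y]]) (simp add: sum_nonneg)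
  ultimately show "(\<Sum>i<m + n. (norm (\<Sum>j<m + n. blinfun_apply (direct_sum_mat m x y i j) (\<xi> j)))\<^sup>2)
      \<le> 1\<^sup>2 * (\<Sum>j<m + n. (norm (\<xi> j))\<^sup>2)"
    by (simp add: sum_lessThan_add direct_sum_mat_simps)
qed simp

lemma scalar_mat_norm_identity_le_1: "scalar_mat_norm n n (\<lambda>i k. if i = k then 1 else 0) \<le> 1"
  by (rule mat_opnorm_leI) (simp_all add: if_distrib[of "\<lambda>c. c * _"] sum.delta cong: if_cong)

section \<open>Scalar matrices acting on sums of Hilbert spaces\<close>

lemma cinner_zero_right [simp]: "cinner x 0 = 0"
  using cinner_add_right[of x 0 0] by simp

lemma cinner_zero_left [simp]: "cinner 0 x = 0"
  using cinner_commute[of 0 x] by simp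

lemma cinner_diff_right: "cinner x (y - z) = cinner x y - cinner x z"
  using cinner_add_right[of x "y - z" z] by simp

lemma cinner_add_left: "cinner (x + y) z = cinner x z + cinner y z"
  by (metis cinner_commute cinner_add_right complex_cnj_add)

lemma cinner_scaleC_left: "cinner (a *\<^sub>C x) y = cnj a * cinner x y"
  by (metis cinner_commute cinner_scaleC_right complex_cnj_mult complex_cnj_cnj)

lemma cinner_sum_right: "cinner x (\<Sum>i\<in>A. f i) = (\<Sum>i\<in>A. cinner x (f i))"
  by (induction A rule: infinite_finite_induct) (simp_all add: cinner_add_right)

lemma cinner_sum_left: "cinner (\<Sum>i\<in>A. f i) x = (\<Sum>i\<in>A. cinner (f i) x)"
  by (induction A rule: infinite_finite_induct) (simp_all add: cinner_add_left)

definition orthonormal_upto :: "nat \<Rightarrow> (nat \<Rightarrow> 'h::chilbert_space) \<Rightarrow> bool" where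
  "orthonormal_upto m e \<longleftrightarrow> (\<forall>r<m. \<forall>s<m. cinner (e r) (e s) = (if r = s then 1 else 0))"

lemma orthonormal_norm_squared:
  assumes "orthonormal_upto m e"
  shows "(norm (\<Sum>r<m. a r *\<^sub>C e r))\<^sup>2 = (\<Sum>r<m. (cmod (a r))\<^sup>2)"
proof -
  have "cinner (\<Sum>r<m. a r *\<^sub>C e r) (\<Sum>r<m. a r *\<^sub>C e r) =
      (\<Sum>r<m. \<Sum>s<m. cnj (a r) * a s * cinner (e r) (e s))"
    by (simp add: cinner_sum_left cinner_sum_right cinner_scaleC_left cinner_scaleC_right
        mult.assoc sum_distrib_left) (subst sum.swap, simp add: mult.left_commute)
  also have "\<dots> = (\<Sum>r<m. \<Sum>s<m. if r = s then cnj (a r) * a s else 0)"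
    using assms by (intro sum.cong refl) (auto simp: orthonormal_upto_def)
  also have "\<dots> = (\<Sum>r<m. cnj (a r) * a r)"
    by (simp add: sum.delta)
  also have "\<dots> = complex_of_real (\<Sum>r<m. (cmod (a r))\<^sup>2)"
    by (simp add: complex_norm_square mult.commute del: of_real_power)
  finally show ?thesis unfolding cinner_norm of_real_eq_iff .
qed

text \<open>Gram--Schmidt orthonormalization, allowing linearly dependent vectors.\<close>

lemma orthonormal_expansion:
  fixes \<xi> :: "nat \<Rightarrow> 'h::chilbert_space"
  shows "\<exists>m e c. orthonormal_upto m e \<and> (\<forall>j<n. \<xi> j = (\<Sum>r<m. c j r *\<^sub>C e r))"
proof (induction n)
  case 0
  show ?case by (rule exI[of _ 0]) (simp add: orthonormal_upto_def)
next
  case (Suc n)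
  then obtain m e c where e: "orthonormal_upto m e"
    and c: "\<And>j. j < n \<Longrightarrow> \<xi> j = (\<Sum>r<m. c j r *\<^sub>C e r)" by blast
  define a where "a r = cinner (e r) (\<xi> n)" for r
  define \<eta> where "\<eta> = \<xi> n - (\<Sum>r<m. a r *\<^sub>C e r)"
  have perp: "cinner (e s) \<eta> = 0" if "s < m" for s
  proof -
    have "(\<Sum>r<m. a r * cinner (e s) (e r)) = (\<Sum>r<m. if r = s then a r else 0)"
      using e that by (intro sum.cong refl) (auto simp: orthonormal_upto_def)
    then show ?thesis
      using that by (simp add: \<eta>_def cinner_diff_right cinner_sum_right cinner_scaleC_right a_def)
  qed
  show ?case
  proof (cases "\<eta> = 0")
    case True
    then have "\<xi> j = (\<Sum>r<m. (c(n := a)) j r *\<^sub>C e r)" if "j < Suc n" for j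
      using that c by (cases "j = n") (auto simp: \<eta>_def)
    with e show ?thesis by blast
  next
    case False
    \<comment> \<open>the new basis vector is the normalized residual, with coefficient \<open>t\<close> in \<open>\<xi> n\<close>\<close>
    define t where "t = complex_of_real (norm \<eta>)"
    have t: "t \<noteq> 0" "cnj t = t" "cinner \<eta> \<eta> = t * t" "inverse t * (inverse t * (t * t)) = 1"
      using False by (simp_all add: t_def cinner_norm power2_eq_square field_simps)
    define e' where "e' = e(m := inverse t *\<^sub>C \<eta>)"
    define c' where "c' j r = (if j < n then if r < m then c j r else 0 else if r < m then a r else t)"
      for j r
    have perp': "cinner \<eta> (e s) = 0" if "s < m" for s
      using perp[OF that] cinner_commute[of \<eta> "e s"] by simp
    have "orthonormal_upto (Suc m) e'"
      using e t by (auto simp: orthonormal_upto_def e'_def less_Suc_eq perp perp'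
          cinner_scaleC_left cinner_scaleC_right)
    moreover have "\<xi> j = (\<Sum>r<Suc m. c' j r *\<^sub>C e' r)" if "j < Suc n" for j
    proof (cases "j = n")
      case True
      have "(\<Sum>r<Suc m. c' j r *\<^sub>C e' r) = (\<Sum>r<m. a r *\<^sub>C e r) + t *\<^sub>C inverse t *\<^sub>C \<eta>"
        using True by (simp add: c'_def e'_def)
      then show ?thesis using t True by (simp add: scaleC_scaleC scaleC_one \<eta>_def)
    next
      case False
      then show ?thesis using that c by (simp add: c'_def e'_def)
    qed
    ultimately show ?thesis by blast
  qed
qed

text \<open>Expanding the vectors in a finite orthonormal family splits the Hilbert sum into finitely many
  copies of the scalar situation, one for each basis vector; hence a scalar matrix has no larger
  norm on copies of \<open>H\<close> than on copies of \<open>\<complex>\<close>.\<close>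

lemma scalar_mat_apply_Hilbert:
  fixes \<xi> :: "nat \<Rightarrow> 'h::chilbert_space"
  shows "(\<Sum>i<p. (norm (\<Sum>j<n. \<alpha> i j *\<^sub>C \<xi> j))\<^sup>2) \<le>
           (scalar_mat_norm p n \<alpha>)\<^sup>2 * (\<Sum>j<n. (norm (\<xi> j))\<^sup>2)"
proof -
  obtain m e c where e: "orthonormal_upto m e"
    and c: "\<And>j. j < n \<Longrightarrow> \<xi> j = (\<Sum>r<m. c j r *\<^sub>C e r)"
    using orthonormal_expansion[of n \<xi>] by blast
  have "(\<Sum>j<n. \<alpha> i j *\<^sub>C \<xi> j) = (\<Sum>r<m. (\<Sum>j<n. \<alpha> i j * c j r) *\<^sub>C e r)" for i
    by (simp add: c cvs.scale_sum_right cvs.scale_sum_left scaleC_scaleC)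
      (rule sum.swap)
  then have "(\<Sum>i<p. (norm (\<Sum>j<n. \<alpha> i j *\<^sub>C \<xi> j))\<^sup>2) =
      (\<Sum>i<p. \<Sum>r<m. (cmod (\<Sum>j<n. \<alpha> i j * c j r))\<^sup>2)"
    by (simp add: orthonormal_norm_squared[OF e])
  also have "\<dots> = (\<Sum>r<m. \<Sum>i<p. (cmod (\<Sum>j<n. \<alpha> i j * c j r))\<^sup>2)"
    by (rule sum.swap)
  also have "\<dots> \<le> (\<Sum>r<m. (scalar_mat_norm p n \<alpha>)\<^sup>2 * (\<Sum>j<n. (cmod (c j r))\<^sup>2))"
    by (intro sum_mono scalar_mat_norm_apply_squared)
  also have "\<dots> = (scalar_mat_norm p n \<alpha>)\<^sup>2 * (\<Sum>j<n. \<Sum>r<m. (cmod (c j r))\<^sup>2)"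
    unfolding sum_distrib_left[symmetric] by (subst sum.swap) (rule refl)
  also have "\<dots> = (scalar_mat_norm p n \<alpha>)\<^sup>2 * (\<Sum>j<n. (norm (\<xi> j))\<^sup>2)"
    by (simp add: c orthonormal_norm_squared[OF e])
  finally show ?thesis .
qed

lemma blinfun_apply_sum: "blinfun_apply (\<Sum>i\<in>A. f i) v = (\<Sum>i\<in>A. blinfun_apply (f i) v)"
  by (induction A rule: infinite_finite_induct) (simp_all add: blinfun.add_left)

lemma bounded_ops_apply_sum:
  assumes "T \<in> bounded_ops"
  shows "blinfun_apply T (\<Sum>i\<in>A. c i *\<^sub>C f i) = (\<Sum>i\<in>A. c i *\<^sub>C blinfun_apply T (f i))"
  using assms by (simp add: blinfun.sum_right bounded_ops_def)

text \<open>The matrix on the left acts as the composition of \<open>\<beta>\<close>, \<open>z\<close> and \<open>\<alpha>\<close>. Moving the scalars of \<open>\<beta>\<close>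
  past the entries of \<open>z\<close> uses that these are complex-linear.\<close>

lemma op_mat_norm_scalar_products:
  assumes z: "z \<in> mats n bounded_ops"
  shows "op_mat_norm p (\<lambda>i j. \<Sum>k<n. \<Sum>l<n. (\<alpha> i k * \<beta> l j) *\<^sub>C z k l) \<le>
           scalar_mat_norm p n \<alpha> * op_mat_norm n z * scalar_mat_norm n p \<beta>" (is "_ \<le> ?a * ?z * ?b")
proof (rule mat_opnorm_leI)
  show "0 \<le> ?a * ?z * ?b"
    by (intro mult_nonneg_nonneg scalar_mat_norm_nonneg op_mat_norm_nonneg)
  fix \<xi> :: "nat \<Rightarrow> 'a"
  define \<eta> where "\<eta> l = (\<Sum>j<p. \<beta> l j *\<^sub>C \<xi> j)" for l
  define \<zeta> where "\<zeta> k = (\<Sum>l<n. blinfun_apply (z k l) (\<eta> l))" for k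
  have "(\<Sum>j<p. blinfun_apply (\<Sum>k<n. \<Sum>l<n. (\<alpha> i k * \<beta> l j) *\<^sub>C z k l) (\<xi> j)) =
      (\<Sum>k<n. \<alpha> i k *\<^sub>C \<zeta> k)" for i
  proof -
    have "(\<Sum>j<p. blinfun_apply (\<Sum>k<n. \<Sum>l<n. (\<alpha> i k * \<beta> l j) *\<^sub>C z k l) (\<xi> j)) =
        (\<Sum>j<p. \<Sum>k<n. \<Sum>l<n. (\<alpha> i k * \<beta> l j) *\<^sub>C blinfun_apply (z k l) (\<xi> j))"
      by (simp add: blinfun_apply_sum scaleC_blinfun.rep_eq)
    also have "\<dots> = (\<Sum>k<n. \<Sum>j<p. \<Sum>l<n. (\<alpha> i k * \<beta> l j) *\<^sub>C blinfun_apply (z k l) (\<xi> j))"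
      by (rule sum.swap)
    also have "\<dots> = (\<Sum>k<n. \<Sum>l<n. \<Sum>j<p. (\<alpha> i k * \<beta> l j) *\<^sub>C blinfun_apply (z k l) (\<xi> j))"
      by (intro sum.cong refl sum.swap)
    also have "\<dots> = (\<Sum>k<n. \<alpha> i k *\<^sub>C \<zeta> k)"
    proof (intro sum.cong refl)
      fix k assume k: "k \<in> {..<n}"
      have "\<zeta> k = (\<Sum>l<n. \<Sum>j<p. \<beta> l j *\<^sub>C blinfun_apply (z k l) (\<xi> j))"
        unfolding \<zeta>_def \<eta>_def
        using z k by (intro sum.cong refl bounded_ops_apply_sum) (simp add: mats_def)
      then show "(\<Sum>l<n. \<Sum>j<p. (\<alpha> i k * \<beta> l j) *\<^sub>C blinfun_apply (z k l) (\<xi> j)) = \<alpha> i k *\<^sub>C \<zeta> k"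
        by (simp add: cvs.scale_sum_right scaleC_scaleC)
    qed
    finally show ?thesis .
  qed
  then have "(\<Sum>i<p. (norm (\<Sum>j<p. blinfun_apply (\<Sum>k<n. \<Sum>l<n. (\<alpha> i k * \<beta> l j) *\<^sub>C z k l) (\<xi> j)))\<^sup>2) =
      (\<Sum>i<p. (norm (\<Sum>k<n. \<alpha> i k *\<^sub>C \<zeta> k))\<^sup>2)" by simp
  also have "\<dots> \<le> ?a\<^sup>2 * (\<Sum>k<n. (norm (\<zeta> k))\<^sup>2)" by (rule scalar_mat_apply_Hilbert)
  also have "\<dots> \<le> ?a\<^sup>2 * (?z\<^sup>2 * (\<Sum>l<n. (norm (\<eta> l))\<^sup>2))"
    unfolding \<zeta>_def by (intro mult_left_mono op_mat_norm_apply_squared) simp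
  also have "\<dots> \<le> ?a\<^sup>2 * (?z\<^sup>2 * (?b\<^sup>2 * (\<Sum>j<p. (norm (\<xi> j))\<^sup>2)))"
    unfolding \<eta>_def by (intro mult_left_mono scalar_mat_apply_Hilbert) simp_all
  finally show "(\<Sum>i<p. (norm (\<Sum>j<p. blinfun_apply (\<Sum>k<n. \<Sum>l<n. (\<alpha> i k * \<beta> l j) *\<^sub>C z k l) (\<xi> j)))\<^sup>2)
      \<le> (?a * ?z * ?b)\<^sup>2 * (\<Sum>j<p. (norm (\<xi> j))\<^sup>2)"
    by (simp add: power_mult_distrib mult.assoc)
qed

section \<open>Completion with respect to matrix seminorms\<close>

lemma op_mat_norm_le_limit:
  assumes z: "\<And>i j. i < n \<Longrightarrow> j < n \<Longrightarrow> (\<lambda>k. z k i j) \<longlonglongrightarrow> z' i j"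
    and c: "\<And>k. op_mat_norm n (z k) \<le> c k" "c \<longlonglongrightarrow> c'"
  shows "op_mat_norm n z' \<le> c'"
proof -
  have le: "op_mat_norm n z' \<le> c k + (\<Sum>i<n. \<Sum>j<n. norm (z' i j - z k i j))" for k
    using op_mat_norm_add[of n n "z k" "\<lambda>i j. z' i j - z k i j"] c(1)[of k]
      op_mat_norm_le_sum[of n "\<lambda>i j. z' i j - z k i j"] by simp
  have "(\<lambda>k. norm (z' i j - z k i j)) \<longlonglongrightarrow> 0" if "i < n" "j < n" for i j
    using tendsto_norm[OF tendsto_diff[OF tendsto_const[of "z' i j"] z[OF that]]] by simp
  then have "(\<lambda>k. \<Sum>i<n. \<Sum>j<n. norm (z' i j - z k i j)) \<longlonglongrightarrow> (\<Sum>i<n. \<Sum>j<n. 0)"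
    by (intro tendsto_sum) auto
  from tendsto_add[OF c(2) this]
  have "(\<lambda>k. c k + (\<Sum>i<n. \<Sum>j<n. norm (z' i j - z k i j))) \<longlonglongrightarrow> c'" by simp
  then show ?thesis by (rule LIMSEQ_le_const) (use le in blast)
qed

lemma Cauchy_iff_prod_filter:
  fixes f :: "nat \<Rightarrow> 'a::metric_space"
  assumes "((\<lambda>p. dist (f (fst p)) (f (snd p))) \<longlongrightarrow> 0) (sequentially \<times>\<^sub>F sequentially)"
  shows "Cauchy f"
proof (rule metric_CauchyI)
  fix e :: real assume "0 < e"
  with assms have "\<forall>\<^sub>F p in sequentially \<times>\<^sub>F sequentially. dist (f (fst p)) (f (snd p)) < e"
    by (auto simp: tendsto_iff)
  then show "\<exists>M. \<forall>m\<ge>M. \<forall>n\<ge>M. dist (f m) (f n) < e"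
    by (auto simp: eventually_prod_sequentially)
qed

lemma tendsto_scaleC:
  fixes f :: "'a \<Rightarrow> 'b::complex_normed_vector"
  assumes "(f \<longlongrightarrow> l) F"
  shows "((\<lambda>x. c *\<^sub>C f x) \<longlongrightarrow> c *\<^sub>C l) F"
proof (rule LIM_zero_cancel, rule Lim_null_comparison)
  show "((\<lambda>x. cmod c * norm (f x - l)) \<longlongrightarrow> 0) F"
    by (rule tendsto_mult_right_zero[OF tendsto_norm_zero[OF LIM_zero[OF assms]]])
qed (simp add: norm_scaleC cvs.scale_right_diff_distrib[symmetric])

text \<open>The bound by the entries makes all the norms \<open>\<nu> n\<close> uniformly continuous for \<open>\<nu> 1\<close>, the norm that
  defines the completion; so they pass to it.\<close>

locale matrix_seminorm =
  fixes T :: "'t::complex_vector set" and \<nu> :: "nat \<Rightarrow> (nat \<Rightarrow> nat \<Rightarrow> 't) \<Rightarrow> real"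
  assumes subspace: "cvs.subspace T"
    and nonneg: "u \<in> mats n T \<Longrightarrow> 0 \<le> \<nu> n u"
    and triangle: "u \<in> mats n T \<Longrightarrow> v \<in> mats n T \<Longrightarrow> \<nu> n (\<lambda>i j. u i j + v i j) \<le> \<nu> n u + \<nu> n v"
    and scale: "u \<in> mats n T \<Longrightarrow> \<nu> n (\<lambda>i j. c *\<^sub>C u i j) \<le> cmod c * \<nu> n u"
    and le_entries: "u \<in> mats n T \<Longrightarrow> \<nu> n u \<le> (\<Sum>i<n. \<Sum>j<n. \<nu> 1 (\<lambda>_ _. u i j))"
begin

definition seminorm :: "'t \<Rightarrow> real" where
  "seminorm t = \<nu> 1 (\<lambda>_ _. t)"

abbreviation "cls s \<equiv> null_rel T \<nu> `` {s}"

lemmas T_zero = cvs.subspace_0[OF subspace]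
lemmas T_add = cvs.subspace_add[OF subspace]
lemmas T_diff = cvs.subspace_diff[OF subspace]
lemmas T_scale = cvs.subspace_scale[OF subspace]

lemma constant_mats [simp]: "t \<in> T \<Longrightarrow> (\<lambda>_ _. t) \<in> mats n T"
  by (simp add: mats_def)

lemma seminorm_nonneg: "t \<in> T \<Longrightarrow> 0 \<le> seminorm t"
  by (simp add: seminorm_def nonneg)

lemma seminorm_add: "s \<in> T \<Longrightarrow> t \<in> T \<Longrightarrow> seminorm (s + t) \<le> seminorm s + seminorm t"
  using triangle[of "\<lambda>_ _. s" 1 "\<lambda>_ _. t"] by (simp add: seminorm_def)

lemma seminorm_scale: "t \<in> T \<Longrightarrow> seminorm (c *\<^sub>C t) \<le> cmod c * seminorm t"
  using scale[of "\<lambda>_ _. t" 1 c] by (simp add: seminorm_def)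

lemma seminorm_zero: "seminorm 0 = 0"
  using seminorm_scale[OF T_zero, of 0] seminorm_nonneg[OF T_zero] by simp

lemma norm_diff_commute: 
  assumes "u \<in> mats n T" "v \<in> mats n T"
  shows "\<nu> n (\<lambda>i j. u i j - v i j) = \<nu> n (\<lambda>i j. v i j - u i j)"
proof -
  have le: "\<nu> n (\<lambda>i j. u i j - v i j) \<le> \<nu> n (\<lambda>i j. v i j - u i j)"
    if "u \<in> mats n T" "v \<in> mats n T" for u v
    using scale[of "\<lambda>i j. v i j - u i j" n "-1"] that by (simp add: mats_def T_diff)
  show ?thesis using le[of u v] le[of v u] assms by (intro antisym)
qed

lemma seminorm_diff_commute: "s \<in> T \<Longrightarrow> t \<in> T \<Longrightarrow> seminorm (s - t) = seminorm (t - s)"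
  using norm_diff_commute[of "\<lambda>_ _. s" 1 "\<lambda>_ _. t"] by (simp add: seminorm_def)

lemma abs_norm_diff_le:
  assumes u: "u \<in> mats n T" and v: "v \<in> mats n T"
  shows "\<bar>\<nu> n u - \<nu> n v\<bar> \<le> (\<Sum>i<n. \<Sum>j<n. seminorm (u i j - v i j))"
proof -
  have d: "(\<lambda>i j. u i j - v i j) \<in> mats n T" if "u \<in> mats n T" "v \<in> mats n T" for u v
    using that by (simp add: mats_def T_diff)
  have "\<nu> n u \<le> \<nu> n v + \<nu> n (\<lambda>i j. u i j - v i j)" "\<nu> n v \<le> \<nu> n u + \<nu> n (\<lambda>i j. u i j - v i j)"
    using triangle[OF v d[OF u v]] triangle[OF u d[OF v u]] norm_diff_commute[OF u v] by simp_all
  with le_entries[OF d[OF u v]] show ?thesis unfolding seminorm_def by linarith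
qed

lemma cauchy_seqs_seminorm:
  "cauchy_seqs T \<nu> = {s. range s \<subseteq> T \<and> (\<forall>e>0. \<exists>N. \<forall>k\<ge>N. \<forall>l\<ge>N. seminorm (s k - s l) < e)}"
  by (simp only: cauchy_seqs_def seminorm_def)

lemma null_rel_seminorm:
  "null_rel T \<nu> = {(s, t). s \<in> cauchy_seqs T \<nu> \<and> t \<in> cauchy_seqs T \<nu> \<and>
     (\<lambda>k. seminorm (s k - t k)) \<longlonglongrightarrow> 0}"
  by (simp only: null_rel_def seminorm_def)

text \<open>Stated with a filter so that bounds between Cauchy sequences become comparisons of limits.\<close>

lemma cauchy_seqs_iff:
  "s \<in> cauchy_seqs T \<nu> \<longleftrightarrow> range s \<subseteq> T \<and>
     ((\<lambda>p. seminorm (s (fst p) - s (snd p))) \<longlongrightarrow> 0) (sequentially \<times>\<^sub>F sequentially)"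
proof (cases "range s \<subseteq> T")
  case True
  then have T: "s k \<in> T" for k by auto
  have "\<bar>seminorm (s k - s l)\<bar> = seminorm (s k - s l)" for k l
    using seminorm_nonneg[OF T_diff[OF T T]] by simp
  moreover have "seminorm (s l - s k) = seminorm (s k - s l)" for k l
    by (rule seminorm_diff_commute[OF T T])
  ultimately show ?thesis
    using True by (simp add: cauchy_seqs_seminorm tendsto_iff eventually_prod_sequentially)
qed (simp add: cauchy_seqs_seminorm)

lemma cauchy_seqs_in: "s \<in> cauchy_seqs T \<nu> \<Longrightarrow> s k \<in> T"
  by (auto simp: cauchy_seqs_seminorm)

lemma cauchy_seqs_add:
  assumes s: "s \<in> cauchy_seqs T \<nu>" and t: "t \<in> cauchy_seqs T \<nu>"
  shows "(\<lambda>k. s k + t k) \<in> cauchy_seqs T \<nu>"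
proof -
  note T = cauchy_seqs_in[OF s] cauchy_seqs_in[OF t]
  have "((\<lambda>p. seminorm (s (fst p) + t (fst p) - (s (snd p) + t (snd p)))) \<longlongrightarrow> 0)
      (sequentially \<times>\<^sub>F sequentially)"
  proof (rule Lim_null_comparison)
    show "((\<lambda>p. seminorm (s (fst p) - s (snd p)) + seminorm (t (fst p) - t (snd p))) \<longlongrightarrow> 0)
        (sequentially \<times>\<^sub>F sequentially)"
      using s t tendsto_add[of _ 0 _ _ 0] by (auto simp: cauchy_seqs_iff)
    have "norm (seminorm (s k + t k - (s l + t l))) \<le> seminorm (s k - s l) + seminorm (t k - t l)" for k l
      using seminorm_add[OF T_diff T_diff, of "s k" "s l" "t k" "t l"] T
        seminorm_nonneg[of "s k + t k - (s l + t l)"]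
      by (simp add: T_add T_diff add_diff_add)
    then show "\<forall>\<^sub>F p in sequentially \<times>\<^sub>F sequentially.
        norm (seminorm (s (fst p) + t (fst p) - (s (snd p) + t (snd p)))) \<le>
          seminorm (s (fst p) - s (snd p)) + seminorm (t (fst p) - t (snd p))"
      by simp
  qed
  with T show ?thesis by (auto simp: cauchy_seqs_iff T_add)
qed

lemma cauchy_seqs_scale:
  assumes s: "s \<in> cauchy_seqs T \<nu>"
  shows "(\<lambda>k. c *\<^sub>C s k) \<in> cauchy_seqs T \<nu>"
proof -
  note T = cauchy_seqs_in[OF s]
  have "((\<lambda>p. seminorm (c *\<^sub>C s (fst p) - c *\<^sub>C s (snd p))) \<longlongrightarrow> 0) (sequentially \<times>\<^sub>F sequentially)"
  proof (rule Lim_null_comparison)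
    show "((\<lambda>p. cmod c * seminorm (s (fst p) - s (snd p))) \<longlongrightarrow> 0) (sequentially \<times>\<^sub>F sequentially)"
      using s by (auto simp: cauchy_seqs_iff intro: tendsto_mult_right_zero)
    have "norm (seminorm (c *\<^sub>C s k - c *\<^sub>C s l)) \<le> cmod c * seminorm (s k - s l)" for k l
      using seminorm_scale[OF T_diff, of "s k" "s l" c] T
        seminorm_nonneg[of "c *\<^sub>C (s k - s l)"]
      by (simp add: T_scale T_diff cvs.scale_right_diff_distrib)
    then show "\<forall>\<^sub>F p in sequentially \<times>\<^sub>F sequentially.
        norm (seminorm (c *\<^sub>C s (fst p) - c *\<^sub>C s (snd p))) \<le> cmod c * seminorm (s (fst p) - s (snd p))"
      by simp
  qed
  with T show ?thesis by (auto simp: cauchy_seqs_iff T_scale)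
qed

lemma constant_cauchy: "t \<in> T \<Longrightarrow> (\<lambda>_. t) \<in> cauchy_seqs T \<nu>"
  by (auto simp: cauchy_seqs_iff seminorm_zero)

lemma cauchy_seqs_diff_constant:
  assumes "s \<in> cauchy_seqs T \<nu>" "t \<in> T"
  shows "(\<lambda>k. s k - t) \<in> cauchy_seqs T \<nu>"
  using cauchy_seqs_add[OF assms(1) constant_cauchy[of "- t"]] assms(2) T_diff[OF T_zero]
  by simp

lemma null_relD:
  assumes "(s, t) \<in> null_rel T \<nu>"
  shows "s \<in> cauchy_seqs T \<nu>" "t \<in> cauchy_seqs T \<nu>" "(\<lambda>k. seminorm (s k - t k)) \<longlonglongrightarrow> 0"
  using assms by (simp_all add: null_rel_seminorm)

lemma null_relI:
  assumes "s \<in> cauchy_seqs T \<nu>" "t \<in> cauchy_seqs T \<nu>" "f \<longlonglongrightarrow> 0"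
    and "\<And>k. seminorm (s k - t k) \<le> f k"
  shows "(s, t) \<in> null_rel T \<nu>"
proof -
  have "(\<lambda>k. seminorm (s k - t k)) \<longlonglongrightarrow> 0"
    by (rule Lim_null_comparison[OF _ assms(3)])
      (use assms seminorm_nonneg[OF T_diff[OF cauchy_seqs_in cauchy_seqs_in]] in simp)
  with assms show ?thesis by (simp add: null_rel_seminorm)
qed

lemma equiv_null_rel: "equiv (cauchy_seqs T \<nu>) (null_rel T \<nu>)"
proof (rule equivI)
  show "null_rel T \<nu> \<subseteq> cauchy_seqs T \<nu> \<times> cauchy_seqs T \<nu>" by (auto simp: null_rel_seminorm)
  show "refl_on (cauchy_seqs T \<nu>) (null_rel T \<nu>)"
    by (rule refl_onI) (auto simp: null_rel_seminorm seminorm_zero)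
  show "sym (null_rel T \<nu>)"
  proof (rule symI)
    fix s t assume st: "(s, t) \<in> null_rel T \<nu>"
    show "(t, s) \<in> null_rel T \<nu>"
      by (rule null_relI[OF null_relD(2,1,3)[OF st]])
        (simp add: seminorm_diff_commute cauchy_seqs_in null_relD[OF st])
  qed
  show "trans (null_rel T \<nu>)"
  proof (rule transI)
    fix s t r assume st: "(s, t) \<in> null_rel T \<nu>" and tr: "(t, r) \<in> null_rel T \<nu>"
    show "(s, r) \<in> null_rel T \<nu>"
    proof (rule null_relI[OF null_relD(1)[OF st] null_relD(2)[OF tr]])
      show "(\<lambda>k. seminorm (s k - t k) + seminorm (t k - r k)) \<longlonglongrightarrow> 0"
        using tendsto_add[OF null_relD(3)[OF st] null_relD(3)[OF tr]] by simp
      show "seminorm (s k - r k) \<le> seminorm (s k - t k) + seminorm (t k - r k)" for k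
        using seminorm_add[OF T_diff T_diff, of "s k" "t k" "t k" "r k"]
          null_relD(1,2)[OF st] null_relD(2)[OF tr] by (simp add: cauchy_seqs_in)
    qed
  qed
qed

lemma pts_completion: "pts (completion T \<nu>) = cauchy_seqs T \<nu> // null_rel T \<nu>"
  by (simp add: completion_def)

lemma cls_in_pts: "s \<in> cauchy_seqs T \<nu> \<Longrightarrow> cls s \<in> pts (completion T \<nu>)"
  by (simp add: pts_completion quotientI)

lemma mem_cls: "s \<in> cauchy_seqs T \<nu> \<Longrightarrow> s \<in> cls s"
  by (rule equiv_class_self[OF equiv_null_rel])

lemma cls_eqI: "(s, t) \<in> null_rel T \<nu> \<Longrightarrow> cls s = cls t"
  by (rule equiv_class_eq[OF equiv_null_rel])

lemma pts_mem_cauchy: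
  assumes "A \<in> pts (completion T \<nu>)" "s \<in> A"
  shows "s \<in> cauchy_seqs T \<nu>"
  using assms by (auto simp: pts_completion null_rel_seminorm elim!: quotientE)

lemma pts_mem_null_rel:
  assumes "A \<in> pts (completion T \<nu>)" "s \<in> A" "t \<in> A"
  shows "(s, t) \<in> null_rel T \<nu>"
  using quotient_eq_iff[OF equiv_null_rel] assms by (auto simp: pts_completion)

lemma pts_eq_cls:
  assumes "A \<in> pts (completion T \<nu>)" "s \<in> A"
  shows "A = cls s"
  using assms by (auto simp: pts_completion elim!: quotientE dest: cls_eqI)

lemma pts_rep:
  assumes "A \<in> pts (completion T \<nu>)"
  shows "(SOME s. s \<in> A) \<in> A"
  using assms in_quotient_imp_non_empty[OF equiv_null_rel] some_in_eq[of A]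
  by (simp add: pts_completion)

lemma add_cls:
  assumes "s \<in> cauchy_seqs T \<nu>" "t \<in> cauchy_seqs T \<nu>"
  shows "add (completion T \<nu>) (cls s) (cls t) = cls (\<lambda>k. s k + t k)"
proof -
  have "cls (\<lambda>k. s' k + t' k) = cls (\<lambda>k. s k + t k)"
    if s': "s' \<in> cls s" and t': "t' \<in> cls t" for s' t'
  proof (rule cls_eqI, rule null_relI)
    from s' t' have st: "(s, s') \<in> null_rel T \<nu>" "(t, t') \<in> null_rel T \<nu>" by simp_all
    note C = null_relD[OF st(1)] null_relD[OF st(2)]
    show "(\<lambda>k. s' k + t' k) \<in> cauchy_seqs T \<nu>" "(\<lambda>k. s k + t k) \<in> cauchy_seqs T \<nu>"
      using C by (simp_all add: cauchy_seqs_add)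
    show "(\<lambda>k. seminorm (s k - s' k) + seminorm (t k - t' k)) \<longlonglongrightarrow> 0"
      using tendsto_add[OF C(3) C(6)] by simp
    show "seminorm (s' k + t' k - (s k + t k)) \<le> seminorm (s k - s' k) + seminorm (t k - t' k)" for k
      using seminorm_add[OF T_diff T_diff, of "s' k" "s k" "t' k" "t k"] C
        seminorm_diff_commute[of "s k" "s' k"] seminorm_diff_commute[of "t k" "t' k"]
      by (simp add: cauchy_seqs_in add_diff_add)
  qed
  then have "(\<Union>s'\<in>cls s. \<Union>t'\<in>cls t. cls (\<lambda>k. s' k + t' k)) =
      (\<Union>s'\<in>cls s. \<Union>t'\<in>cls t. cls (\<lambda>k. s k + t k))"
    by (intro SUP_cong refl)
  also have "\<dots> = cls (\<lambda>k. s k + t k)" using mem_cls[OF assms(1)] mem_cls[OF assms(2)] by blast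
  finally show ?thesis by (simp add: completion_def)
qed

lemma scl_cls:
  assumes "s \<in> cauchy_seqs T \<nu>"
  shows "scl (completion T \<nu>) c (cls s) = cls (\<lambda>k. c *\<^sub>C s k)"
proof -
  have "cls (\<lambda>k. c *\<^sub>C s' k) = cls (\<lambda>k. c *\<^sub>C s k)" if s': "s' \<in> cls s" for s'
  proof (rule cls_eqI, rule null_relI)
    from s' have "(s, s') \<in> null_rel T \<nu>" by simp
    note C = null_relD[OF this]
    show "(\<lambda>k. c *\<^sub>C s' k) \<in> cauchy_seqs T \<nu>" "(\<lambda>k. c *\<^sub>C s k) \<in> cauchy_seqs T \<nu>"
      using C by (simp_all add: cauchy_seqs_scale)
    show "(\<lambda>k. cmod c * seminorm (s k - s' k)) \<longlonglongrightarrow> 0"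
      by (rule tendsto_mult_right_zero[OF C(3)])
    show "seminorm (c *\<^sub>C s' k - c *\<^sub>C s k) \<le> cmod c * seminorm (s k - s' k)" for k
      using seminorm_scale[OF T_diff, of "s' k" "s k" c] C seminorm_diff_commute[of "s k" "s' k"]
      by (simp add: cauchy_seqs_in cvs.scale_right_diff_distrib)
  qed
  then have "(\<Union>s'\<in>cls s. cls (\<lambda>k. c *\<^sub>C s' k)) = (\<Union>s'\<in>cls s. cls (\<lambda>k. c *\<^sub>C s k))"
    by (intro SUP_cong refl)
  also have "\<dots> = cls (\<lambda>k. c *\<^sub>C s k)" using mem_cls[OF assms] by blast
  finally show ?thesis by (simp add: completion_def)
qed

text \<open>The norm of a matrix of classes is independent of the representing sequences, because the
  norm of a matrix is controlled by the norms of its entries.\<close>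

lemma mnorm_completion_tendsto:
  assumes a: "a \<in> mats n (pts (completion T \<nu>))"
    and s: "\<And>i j. i < n \<Longrightarrow> j < n \<Longrightarrow> s i j \<in> a i j"
  shows "(\<lambda>k. \<nu> n (\<lambda>i j. s i j k)) \<longlonglongrightarrow> mnorm (completion T \<nu>) n a"
proof -
  define r where "r i j = (SOME s. s \<in> a i j)" for i j
  have P: "a i j \<in> pts (completion T \<nu>)" if "i < n" "j < n" for i j
    using a that by (simp add: mats_def)
  have r: "r i j \<in> a i j" if "i < n" "j < n" for i j
    unfolding r_def by (rule pts_rep[OF P[OF that]])
  have rC: "r i j \<in> cauchy_seqs T \<nu>" and sC: "s i j \<in> cauchy_seqs T \<nu>"
    and rs: "(s i j, r i j) \<in> null_rel T \<nu>" if "i < n" "j < n" for i j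
    by (rule pts_mem_cauchy[OF P[OF that] r[OF that]] pts_mem_cauchy[OF P[OF that] s[OF that]]
        pts_mem_null_rel[OF P[OF that] s[OF that] r[OF that]])+
  have rT: "(\<lambda>i j. r i j k) \<in> mats n T" and sT: "(\<lambda>i j. s i j k) \<in> mats n T" for k
    using cauchy_seqs_in[OF rC] cauchy_seqs_in[OF sC] by (simp_all add: mats_def)
  have "((\<lambda>p. dist (\<nu> n (\<lambda>i j. r i j (fst p))) (\<nu> n (\<lambda>i j. r i j (snd p)))) \<longlongrightarrow> 0)
      (sequentially \<times>\<^sub>F sequentially)"
  proof (rule Lim_null_comparison)
    have "((\<lambda>p. \<Sum>i<n. \<Sum>j<n. seminorm (r i j (fst p) - r i j (snd p))) \<longlongrightarrow> (\<Sum>i<n. \<Sum>j<n. 0))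
        (sequentially \<times>\<^sub>F sequentially)"
      using rC by (intro tendsto_sum) (simp add: cauchy_seqs_iff)
    then show "((\<lambda>p. \<Sum>i<n. \<Sum>j<n. seminorm (r i j (fst p) - r i j (snd p))) \<longlongrightarrow> 0)
        (sequentially \<times>\<^sub>F sequentially)" by simp
  qed (use abs_norm_diff_le[OF rT rT] in \<open>simp add: dist_real_def\<close>)
  then have "convergent (\<lambda>k. \<nu> n (\<lambda>i j. r i j k))"
    by (intro Cauchy_convergent Cauchy_iff_prod_filter)
  then have R: "(\<lambda>k. \<nu> n (\<lambda>i j. r i j k)) \<longlonglongrightarrow> mnorm (completion T \<nu>) n a"
    by (simp add: completion_def r_def convergent_LIMSEQ_iff)
  have "(\<lambda>k. \<nu> n (\<lambda>i j. s i j k) - \<nu> n (\<lambda>i j. r i j k)) \<longlonglongrightarrow> 0"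
  proof (rule Lim_null_comparison)
    have "(\<lambda>k. \<Sum>i<n. \<Sum>j<n. seminorm (s i j k - r i j k)) \<longlonglongrightarrow> (\<Sum>i<n. \<Sum>j<n. 0)"
      by (intro tendsto_sum) (use null_relD(3)[OF rs] in simp)
    then show "(\<lambda>k. \<Sum>i<n. \<Sum>j<n. seminorm (s i j k - r i j k)) \<longlonglongrightarrow> 0" by simp
  qed (use abs_norm_diff_le[OF sT rT] in simp)
  from tendsto_add[OF this R] show ?thesis by simp
qed

lemma mnorm_completion_constants:
  assumes "u \<in> mats n T"
  shows "mnorm (completion T \<nu>) n (\<lambda>i j. cls (\<lambda>_. u i j)) = \<nu> n u"
proof -
  have "(\<lambda>k. \<nu> n (\<lambda>i j. (\<lambda>_. u i j) k)) \<longlonglongrightarrow> mnorm (completion T \<nu>) n (\<lambda>i j. cls (\<lambda>_. u i j))"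
    by (rule mnorm_completion_tendsto, use assms in \<open>simp add: mats_def cls_in_pts constant_cauchy\<close>)
      (use assms in \<open>auto simp: mats_def simp del: Image_singleton_iff intro!: mem_cls constant_cauchy\<close>)
  then show ?thesis by (simp add: LIMSEQ_const_iff)
qed

lemma mnorm_completion_nonneg:
  assumes "a \<in> mats n (pts (completion T \<nu>))"
  shows "0 \<le> mnorm (completion T \<nu>) n a"
proof -
  have P: "a i j \<in> pts (completion T \<nu>)" if "i < n" "j < n" for i j
    using assms that by (simp add: mats_def)
  show ?thesis
    by (rule LIMSEQ_le_const[OF mnorm_completion_tendsto[OF assms, of "\<lambda>i j. SOME s. s \<in> a i j"]])
      (auto simp: pts_rep P mats_def intro!: exI[of _ 0] nonneg cauchy_seqs_in pts_mem_cauchy[OF P])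
qed

text \<open>Constant sequences are dense, so a bounded linear map on the completion is determined by its
  values on them.\<close>

lemma bounded_map_tendsto:
  assumes \<psi>: "linear_map (completion T \<nu>) (opspace X) \<psi>"
    and C: "\<forall>n\<ge>1. \<forall>x\<in>mats n (pts (completion T \<nu>)).
          mnorm (opspace X) n (\<lambda>i j. \<psi> (x i j)) \<le> C * mnorm (completion T \<nu>) n x"
    and A: "A \<in> pts (completion T \<nu>)" "s \<in> A"
  shows "(\<lambda>k. \<psi> (cls (\<lambda>_. s k))) \<longlonglongrightarrow> \<psi> A"
proof -
  have s: "s \<in> cauchy_seqs T \<nu>" by (rule pts_mem_cauchy[OF A])
  let ?d = "\<lambda>k l. s l - s k"
  have dC: "?d k \<in> cauchy_seqs T \<nu>" for k
    by (rule cauchy_seqs_diff_constant[OF s cauchy_seqs_in[OF s]])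
  have kC: "(\<lambda>_. s k) \<in> cauchy_seqs T \<nu>" for k
    by (rule constant_cauchy[OF cauchy_seqs_in[OF s]])
  \<comment> \<open>\<open>A\<close> minus the constant \<open>s k\<close> is the class of \<open>l \<mapsto> s l - s k\<close>, whose norm is the limit over \<open>l\<close>\<close>
  have eq: "\<psi> A = \<psi> (cls (?d k)) + \<psi> (cls (\<lambda>_. s k))" for k
  proof -
    have "A = add (completion T \<nu>) (cls (?d k)) (cls (\<lambda>_. s k))"
      using pts_eq_cls[OF A] by (simp add: add_cls[OF dC kC])
    then show ?thesis
      using \<psi> cls_in_pts[OF dC] cls_in_pts[OF kC] by (simp add: linear_map_def opspace_def)
  qed
  have norm_le: "norm (\<psi> (cls (?d k))) \<le> \<bar>C\<bar> * mnorm (completion T \<nu>) 1 (\<lambda>_ _. cls (?d k))" for k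
  proof -
    have m: "(\<lambda>_ _. cls (?d k)) \<in> mats 1 (pts (completion T \<nu>))"
      using cls_in_pts[OF dC] by (simp add: mats_def)
    have "norm (\<psi> (cls (?d k))) \<le> op_mat_norm 1 (\<lambda>_ _. \<psi> (cls (?d k)))"
      by (rule norm_le_op_mat_norm)
    also have "\<dots> \<le> C * mnorm (completion T \<nu>) 1 (\<lambda>_ _. cls (?d k))"
      using C[rule_format, OF _ m] by (simp add: opspace_def)
    also have "\<dots> \<le> \<bar>C\<bar> * mnorm (completion T \<nu>) 1 (\<lambda>_ _. cls (?d k))"
      by (intro mult_right_mono mnorm_completion_nonneg m) simp
    finally show ?thesis .
  qed
  show ?thesis
  proof (rule LIMSEQ_I)
    fix e :: real assume e: "0 < e"
    define e' where "e' = e / (2 * (\<bar>C\<bar> + 1))"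
    have e': "0 < e'" using e by (simp add: e'_def)
    have "\<forall>e>0. \<exists>N. \<forall>k\<ge>N. \<forall>l\<ge>N. seminorm (s k - s l) < e"
      using s by (simp add: cauchy_seqs_seminorm)
    from this[rule_format, OF e'] obtain N
      where N: "\<And>k l. k \<ge> N \<Longrightarrow> l \<ge> N \<Longrightarrow> seminorm (s k - s l) < e'"
      by blast
    have "norm (\<psi> (cls (\<lambda>_. s k)) - \<psi> A) < e" if k: "k \<ge> N" for k
    proof -
      have "mnorm (completion T \<nu>) 1 (\<lambda>_ _. cls (?d k)) \<le> e'"
      proof (rule LIMSEQ_le_const2)
        show "(\<lambda>l. seminorm (?d k l)) \<longlonglongrightarrow> mnorm (completion T \<nu>) 1 (\<lambda>_ _. cls (?d k))"
          unfolding seminorm_def by (rule mnorm_completion_tendsto)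
            (simp_all add: mats_def cls_in_pts[OF dC] mem_cls[OF dC] del: Image_singleton_iff)
        show "\<exists>N. \<forall>l\<ge>N. seminorm (?d k l) \<le> e'"
          using N k less_imp_le by blast
      qed
      then have "norm (\<psi> (cls (?d k))) \<le> \<bar>C\<bar> * e'"
        using norm_le[of k] by (meson abs_ge_zero mult_left_mono order_trans)
      also have "\<dots> \<le> (\<bar>C\<bar> + 1) * e'" using e' by simp
      also have "\<dots> < e" using e add_pos_nonneg[of e "e * \<bar>C\<bar>"] by (simp add: e'_def field_simps)
      finally show ?thesis using eq[of k] by (simp add: norm_minus_commute)
    qed
    then show "\<exists>N. \<forall>k\<ge>N. norm (\<psi> (cls (\<lambda>_. s k)) - \<psi> A) < e" by blast
  qed
qed

text \<open>The extension takes the class of \<open>s\<close> to the limit of \<open>L \<circ> s\<close>, which exists because \<open>L\<close> is Lipschitz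
  and operators form a Banach space, and lies in \<open>X\<close> because \<open>X\<close> is closed. The bounds for matrices
  hold along representing sequences and survive the limit.\<close>

lemma bounded_map_extension:
  fixes L :: "'t \<Rightarrow> ('l::chilbert_space \<Rightarrow>\<^sub>L 'l)"
  assumes X: "operator_space X"
    and L: "Vector_Spaces.linear scaleC scaleC L" and LX: "\<And>t. t \<in> T \<Longrightarrow> L t \<in> X"
    and C: "\<And>n u. n \<ge> 1 \<Longrightarrow> u \<in> mats n T \<Longrightarrow> op_mat_norm n (\<lambda>i j. L (u i j)) \<le> C * \<nu> n u"
  obtains \<psi> where "linear_map (completion T \<nu>) (opspace X) \<psi>"
    and "\<And>t. t \<in> T \<Longrightarrow> \<psi> (cls (\<lambda>_. t)) = L t"
    and "\<And>n a. n \<ge> 1 \<Longrightarrow> a \<in> mats n (pts (completion T \<nu>)) \<Longrightarrow>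
           mnorm (opspace X) n (\<lambda>i j. \<psi> (a i j)) \<le> C * mnorm (completion T \<nu>) n a"
proof -
  interpret L: Vector_Spaces.linear scaleC scaleC L by fact
  define \<psi> where "\<psi> = (\<lambda>A\<in>pts (completion T \<nu>). lim (\<lambda>k. L ((SOME s. s \<in> A) k)))"
  have L_le: "norm (L t) \<le> C * seminorm t" if "t \<in> T" for t
    using order_trans[OF norm_le_op_mat_norm C[of 1 "\<lambda>_ _. t"]] that
    by (simp add: seminorm_def)
  have lim: "(\<lambda>k. L (s k)) \<longlonglongrightarrow> \<psi> A" if A: "A \<in> pts (completion T \<nu>)" and s: "s \<in> A" for A s
  proof -
    define r where "r = (SOME s. s \<in> A)"
    have r: "r \<in> A" unfolding r_def by (rule pts_rep[OF A])
    have rC: "r \<in> cauchy_seqs T \<nu>" and sr: "(s, r) \<in> null_rel T \<nu>"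
      by (rule pts_mem_cauchy[OF A r] pts_mem_null_rel[OF A s r])+
    have "((\<lambda>p. dist (L (r (fst p))) (L (r (snd p)))) \<longlongrightarrow> 0) (sequentially \<times>\<^sub>F sequentially)"
    proof (rule Lim_null_comparison)
      show "((\<lambda>p. C * seminorm (r (fst p) - r (snd p))) \<longlongrightarrow> 0) (sequentially \<times>\<^sub>F sequentially)"
        using rC by (auto simp: cauchy_seqs_iff intro: tendsto_mult_right_zero)
    qed (use L_le[OF T_diff[OF cauchy_seqs_in[OF rC] cauchy_seqs_in[OF rC]]] in
        \<open>simp add: dist_norm L.diff\<close>)
    then have "convergent (\<lambda>k. L (r k))" by (intro Cauchy_convergent Cauchy_iff_prod_filter)
    then have R: "(\<lambda>k. L (r k)) \<longlonglongrightarrow> \<psi> A"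
      using A by (simp add: \<psi>_def r_def convergent_LIMSEQ_iff)
    have "(\<lambda>k. L (s k) - L (r k)) \<longlonglongrightarrow> 0"
    proof (rule Lim_null_comparison)
      show "(\<lambda>k. C * seminorm (s k - r k)) \<longlonglongrightarrow> 0"
        by (rule tendsto_mult_right_zero[OF null_relD(3)[OF sr]])
    qed (use L_le[OF T_diff[OF cauchy_seqs_in[OF null_relD(1)[OF sr]] cauchy_seqs_in[OF rC]]] in
        \<open>simp add: L.diff\<close>)
    from tendsto_add[OF this R] show ?thesis by simp
  qed
  have uniq: "\<psi> A = l" if "A \<in> pts (completion T \<nu>)" "s \<in> A" "(\<lambda>k. L (s k)) \<longlonglongrightarrow> l" for A s l
    using LIMSEQ_unique[OF lim[OF that(1,2)] that(3)] .
  show thesis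
  proof (rule that[of \<psi>])
    show "linear_map (completion T \<nu>) (opspace X) \<psi>"
      unfolding linear_map_def
    proof (intro conjI ballI allI)
      have "\<psi> A \<in> X" if A: "A \<in> pts (completion T \<nu>)" for A
      proof (rule Lim_in_closed_set[OF _ _ _ lim[OF A pts_rep[OF A]]])
        show "closed X" using X by (simp add: operator_space_def)
      qed (simp_all add: LX cauchy_seqs_in[OF pts_mem_cauchy[OF A pts_rep[OF A]]])
      then show "\<psi> \<in> pts (completion T \<nu>) \<rightarrow>\<^sub>E pts (opspace X)"
        by (simp add: \<psi>_def opspace_def)
    next
      fix A B assume A: "A \<in> pts (completion T \<nu>)" and B: "B \<in> pts (completion T \<nu>)"
      obtain s t where s: "s \<in> A" and t: "t \<in> B" using pts_rep[OF A] pts_rep[OF B] by blast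
      note sC = pts_mem_cauchy[OF A s] and tC = pts_mem_cauchy[OF B t]
      have "\<psi> (cls (\<lambda>k. s k + t k)) = \<psi> A + \<psi> B"
        by (rule uniq[OF cls_in_pts mem_cls])
          (simp_all add: cauchy_seqs_add[OF sC tC] L.add tendsto_add[OF lim[OF A s] lim[OF B t]])
      then show "\<psi> (add (completion T \<nu>) A B) = add (opspace X) (\<psi> A) (\<psi> B)"
        by (simp add: pts_eq_cls[OF A s] pts_eq_cls[OF B t] add_cls[OF sC tC] opspace_def)
    next
      fix c A assume A: "A \<in> pts (completion T \<nu>)"
      obtain s where s: "s \<in> A" using pts_rep[OF A] by blast
      note sC = pts_mem_cauchy[OF A s]
      have "\<psi> (cls (\<lambda>k. c *\<^sub>C s k)) = c *\<^sub>C \<psi> A"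
        by (rule uniq[OF cls_in_pts mem_cls])
          (simp_all add: cauchy_seqs_scale[OF sC] L.scale tendsto_scaleC[OF lim[OF A s]])
      then show "\<psi> (scl (completion T \<nu>) c A) = scl (opspace X) c (\<psi> A)"
        by (simp add: pts_eq_cls[OF A s] scl_cls[OF sC] opspace_def)
    qed
    show "\<psi> (cls (\<lambda>_. t)) = L t" if "t \<in> T" for t
      by (rule uniq[OF cls_in_pts mem_cls]) (simp_all add: constant_cauchy that)
    fix n a assume n: "n \<ge> (1::nat)" and a: "a \<in> mats n (pts (completion T \<nu>))"
    have P: "a i j \<in> pts (completion T \<nu>)" if "i < n" "j < n" for i j
      using a that by (simp add: mats_def)
    define r where "r i j = (SOME s. s \<in> a i j)" for i j
    have r: "r i j \<in> a i j" if "i < n" "j < n" for i j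
      unfolding r_def by (rule pts_rep[OF P[OF that]])
    have "op_mat_norm n (\<lambda>i j. \<psi> (a i j)) \<le> C * mnorm (completion T \<nu>) n a"
    proof (rule op_mat_norm_le_limit)
      show "(\<lambda>k. L (r i j k)) \<longlonglongrightarrow> \<psi> (a i j)" if "i < n" "j < n" for i j
        by (rule lim[OF P[OF that] r[OF that]])
      show "op_mat_norm n (\<lambda>i j. L (r i j k)) \<le> C * \<nu> n (\<lambda>i j. r i j k)" for k
        by (rule C[OF n]) (auto simp: mats_def intro!: cauchy_seqs_in pts_mem_cauchy[OF P r])
      show "(\<lambda>k. C * \<nu> n (\<lambda>i j. r i j k)) \<longlonglongrightarrow> C * mnorm (completion T \<nu>) n a"
        by (intro tendsto_mult_left mnorm_completion_tendsto a r)
    qed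
    then show "mnorm (opspace X) n (\<lambda>i j. \<psi> (a i j)) \<le> C * mnorm (completion T \<nu>) n a"
      by (simp add: opspace_def)
  qed
qed

end

section \<open>The schur norms are matrix seminorms\<close>

lemma le_of_le_add_mult_epsilon:
  fixes a b K :: real
  assumes "0 \<le> K" and "\<And>e. 0 < e \<Longrightarrow> a \<le> b + K * e"
  shows "a \<le> b"
proof (rule field_le_epsilon)
  fix e :: real assume e: "0 < e"
  have "K * (e / (K + 1)) \<le> e" using assms(1) e by (simp add: field_simps)
  with assms(2)[of "e / (K + 1)"] assms(1) e show "a \<le> b + e" by (simp add: add_pos_nonneg)
qed

definition schur_product ::
    "nat \<Rightarrow> (nat \<Rightarrow> nat \<Rightarrow> complex) \<Rightarrow> (nat \<Rightarrow> nat \<Rightarrow> 'a::complex_vector) \<Rightarrow>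
     (nat \<Rightarrow> nat \<Rightarrow> 'b::complex_vector) \<Rightarrow> (nat \<Rightarrow> nat \<Rightarrow> complex) \<Rightarrow> nat \<Rightarrow> nat \<Rightarrow> ('a, 'b) tensor" where
  "schur_product n \<alpha> x y \<beta> i j = (\<Sum>k<n. \<Sum>l<n. (\<alpha> i k * \<beta> l j) *\<^sub>C (x k l \<otimes> y k l))"

text \<open>The normal form of a decomposition with \<open>\<parallel>\<alpha>\<parallel> \<parallel>x\<parallel> \<parallel>y\<parallel> \<parallel>\<beta>\<parallel> \<le> c\<close>. In contrast to the product of four
  norms, the bound \<open>c\<close> is additive under block sums.\<close>

definition balanced_decomp ::
    "('h::chilbert_space \<Rightarrow>\<^sub>L 'h) set \<Rightarrow> ('k::chilbert_space \<Rightarrow>\<^sub>L 'k) set \<Rightarrow> nat \<Rightarrow>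
     (nat \<Rightarrow> nat \<Rightarrow> ('h \<Rightarrow>\<^sub>L 'h, 'k \<Rightarrow>\<^sub>L 'k) tensor) \<Rightarrow> real \<Rightarrow> bool" where
  "balanced_decomp V W p u c \<longleftrightarrow> (\<exists>n \<alpha> x y \<beta>. n \<ge> 1 \<and> x \<in> mats n V \<and> y \<in> mats n W \<and>
     op_mat_norm n x \<le> 1 \<and> op_mat_norm n y \<le> 1 \<and>
     (scalar_mat_norm p n \<alpha>)\<^sup>2 \<le> c \<and> (scalar_mat_norm n p \<beta>)\<^sup>2 \<le> c \<and>
     (\<forall>i<p. \<forall>j<p. u i j = schur_product n \<alpha> x y \<beta> i j))"

lemma balanced_decomp_cong:
  assumes "\<And>i j. i < p \<Longrightarrow> j < p \<Longrightarrow> u i j = v i j"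
  shows "balanced_decomp V W p u c \<longleftrightarrow> balanced_decomp V W p v c"
  using assms by (simp add: balanced_decomp_def cong: conj_cong)

lemma bdd_below_schur_values:
  "bdd_below {scalar_mat_norm p n \<alpha> * op_mat_norm n x * op_mat_norm n y * scalar_mat_norm n p \<beta>
     | n \<alpha> x y \<beta>. n \<ge> 1 \<and> x \<in> mats n V \<and> y \<in> mats n W \<and>
         (\<forall>i<p. \<forall>j<p. u i j = (\<Sum>k<n. \<Sum>l<n. (\<alpha> i k * \<beta> l j) *\<^sub>C (x k l \<otimes> y k l)))}"
  by (rule bdd_belowI[of _ 0])
    (auto intro!: mult_nonneg_nonneg scalar_mat_norm_nonneg op_mat_norm_nonneg)

lemma schur_norm_le:
  assumes "n \<ge> 1" "x \<in> mats n V" "y \<in> mats n W"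
    and "\<And>i j. i < p \<Longrightarrow> j < p \<Longrightarrow> u i j = schur_product n \<alpha> x y \<beta> i j"
    and "scalar_mat_norm p n \<alpha> * op_mat_norm n x * op_mat_norm n y * scalar_mat_norm n p \<beta> \<le> C"
  shows "schur_norm V W p u \<le> C"
  unfolding schur_norm_def
  by (rule cInf_lower2[OF _ assms(5) bdd_below_schur_values])
    (use assms(1-4) in \<open>unfold schur_product_def, blast\<close>)

lemma schur_norm_le_balanced:
  assumes "balanced_decomp V W p u c"
  shows "schur_norm V W p u \<le> c"
proof -
  obtain n \<alpha> x y \<beta> where n: "n \<ge> 1" "x \<in> mats n V" "y \<in> mats n W"
    and x: "op_mat_norm n x \<le> 1" and y: "op_mat_norm n y \<le> 1"
    and a: "(scalar_mat_norm p n \<alpha>)\<^sup>2 \<le> c" and b: "(scalar_mat_norm n p \<beta>)\<^sup>2 \<le> c"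
    and u: "\<And>i j. i < p \<Longrightarrow> j < p \<Longrightarrow> u i j = schur_product n \<alpha> x y \<beta> i j"
    using assms unfolding balanced_decomp_def by blast
  have c: "0 \<le> c" using a by (meson order_trans zero_le_power2)
  have "scalar_mat_norm p n \<alpha> * op_mat_norm n x * op_mat_norm n y * scalar_mat_norm n p \<beta> \<le>
      sqrt c * 1 * 1 * sqrt c"
    by (intro mult_mono x y real_le_rsqrt a b mult_nonneg_nonneg scalar_mat_norm_nonneg
        op_mat_norm_nonneg) (use c in simp_all)
  then show ?thesis using c by (intro schur_norm_le[OF n u]) simp_all
qed

text \<open>Rescaling the four factors of a decomposition. The factors are first made positive by adding
  a small \<open>\<delta>\<close>, since each of them may vanish.\<close>

lemma balanced_decomp_of_product_less:
  assumes V: "cvs.subspace V" and W: "cvs.subspace W"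
    and n: "n \<ge> 1" and x: "x \<in> mats n V" and y: "y \<in> mats n W"
    and u: "\<And>i j. i < p \<Longrightarrow> j < p \<Longrightarrow> u i j = schur_product n \<alpha> x y \<beta> i j"
    and C: "scalar_mat_norm p n \<alpha> * op_mat_norm n x * op_mat_norm n y * scalar_mat_norm n p \<beta> < C"
      (is "?a * ?b * ?c * ?d < C")
  shows "balanced_decomp V W p u C"
proof -
  let ?P = "\<lambda>\<delta>. (?a + \<delta>) * (?b + \<delta>) * (?c + \<delta>) * (?d + \<delta>)"
  have "(\<lambda>k. ?P (inverse (real (Suc k)))) \<longlonglongrightarrow> (?a + 0) * (?b + 0) * (?c + 0) * (?d + 0)"
    by (intro tendsto_mult tendsto_add tendsto_const LIMSEQ_inverse_real_of_nat)
  then have "\<forall>\<^sub>F k in sequentially. ?P (inverse (real (Suc k))) < C"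
    using C by (intro order_tendstoD(2)) simp_all
  then obtain k where k: "?P (inverse (real (Suc k))) < C"
    by (auto simp: eventually_sequentially)
  define \<delta> where "\<delta> = inverse (real (Suc k))"
  have \<delta>: "0 < \<delta>" "?P \<delta> < C" using k by (simp_all add: \<delta>_def)
  define a b c d where "a = ?a + \<delta>" and "b = ?b + \<delta>" and "c = ?c + \<delta>" and "d = ?d + \<delta>"
  have pos: "0 < a" "0 < b" "0 < c" "0 < d"
    unfolding a_def b_def c_def d_def
    by (intro add_nonneg_pos scalar_mat_norm_nonneg op_mat_norm_nonneg \<delta>)+
  have le: "?a \<le> a" "?b \<le> b" "?c \<le> c" "?d \<le> d"
    using \<delta> by (simp_all add: a_def b_def c_def d_def)
  define P where "P = a * b * c * d"
  have P: "0 < P" "P < C" using pos \<delta> by (simp_all add: P_def a_def b_def c_def d_def)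
  define \<alpha>' where "\<alpha>' = (\<lambda>i k. complex_of_real (sqrt P / a) * \<alpha> i k)"
  define \<beta>' where "\<beta>' = (\<lambda>l j. complex_of_real (sqrt P / d) * \<beta> l j)"
  define x' where "x' = (\<lambda>k l. complex_of_real (1 / b) *\<^sub>C x k l)"
  define y' where "y' = (\<lambda>k l. complex_of_real (1 / c) *\<^sub>C y k l)"
  have quot: "0 < sqrt P / a" "0 < sqrt P / d" "0 < 1 / b" "0 < 1 / c" using P pos by simp_all
  have "scalar_mat_norm p n \<alpha>' \<le> sqrt P / a * ?a"
    unfolding \<alpha>'_def using scalar_mat_norm_scale[of p n "complex_of_real (sqrt P / a)" \<alpha>] quot
    by (simp only: norm_of_real abs_of_pos)
  also have "\<dots> \<le> sqrt P / a * a" by (intro mult_left_mono le) (use P pos in simp)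
  finally have a': "scalar_mat_norm p n \<alpha>' \<le> sqrt P" using pos by simp
  have "scalar_mat_norm n p \<beta>' \<le> sqrt P / d * ?d"
    unfolding \<beta>'_def using scalar_mat_norm_scale[of n p "complex_of_real (sqrt P / d)" \<beta>] quot
    by (simp only: norm_of_real abs_of_pos)
  also have "\<dots> \<le> sqrt P / d * d" by (intro mult_left_mono le) (use P pos in simp)
  finally have b': "scalar_mat_norm n p \<beta>' \<le> sqrt P" using pos by simp
  have "op_mat_norm n x' \<le> 1 / b * ?b"
    unfolding x'_def using op_mat_norm_scale[of n "complex_of_real (1 / b)" x] quot
    by (simp only: norm_of_real abs_of_pos)
  also have "\<dots> \<le> 1" using le pos by simp
  finally have x': "op_mat_norm n x' \<le> 1" .
  have "op_mat_norm n y' \<le> 1 / c * ?c"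
    unfolding y'_def using op_mat_norm_scale[of n "complex_of_real (1 / c)" y] quot
    by (simp only: norm_of_real abs_of_pos)
  also have "\<dots> \<le> 1" using le pos by simp
  finally have y': "op_mat_norm n y' \<le> 1" .
  have "sqrt P / a * (sqrt P / d) * (1 / b * (1 / c)) = sqrt P * sqrt P / (a * b * c * d)"
    by (simp add: ac_simps)
  also have "\<dots> = 1" using P pos by (simp add: P_def[symmetric])
  finally have one: "complex_of_real (sqrt P / a) * complex_of_real (sqrt P / d) *
      (complex_of_real (1 / b) * complex_of_real (1 / c)) = 1"
    by (simp only: of_real_mult[symmetric] of_real_1)
  have "schur_product n \<alpha>' x' y' \<beta>' i j = schur_product n \<alpha> x y \<beta> i j" for i j
    unfolding schur_product_def
  proof (intro sum.cong refl)
    fix k l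
    have "(\<alpha>' i k * \<beta>' l j) *\<^sub>C (x' k l \<otimes> y' k l) =
        (complex_of_real (sqrt P / a) * complex_of_real (sqrt P / d) *
          (complex_of_real (1 / b) * complex_of_real (1 / c))) *\<^sub>C (\<alpha> i k * \<beta> l j) *\<^sub>C (x k l \<otimes> y k l)"
      unfolding \<alpha>'_def \<beta>'_def x'_def y'_def tensor_scaleC_left tensor_scaleC_right scaleC_scaleC
      by (simp only: ac_simps)
    then show "(\<alpha>' i k * \<beta>' l j) *\<^sub>C (x' k l \<otimes> y' k l) = (\<alpha> i k * \<beta> l j) *\<^sub>C (x k l \<otimes> y k l)"
      by (simp only: one scaleC_one)
  qed
  moreover have "x' \<in> mats n V" "y' \<in> mats n W"
    using x y cvs.subspace_scale[OF V] cvs.subspace_scale[OF W] by (auto simp: x'_def y'_def mats_def)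
  moreover have "(scalar_mat_norm p n \<alpha>')\<^sup>2 \<le> C" "(scalar_mat_norm n p \<beta>')\<^sup>2 \<le> C"
    using power_mono[OF a' scalar_mat_norm_nonneg, of 2] power_mono[OF b' scalar_mat_norm_nonneg, of 2] P
    by simp_all
  ultimately show ?thesis
    unfolding balanced_decomp_def using n x' y' u by (intro exI[of _ n] exI[of _ \<alpha>'] exI[of _ x'] exI[of _ y'] exI[of _ \<beta>']) simp
qed

lemma op_mat_norm_zero: "op_mat_norm n (\<lambda>_ _. 0) = 0"
  by (intro antisym order_trans[OF op_mat_norm_le_sum] op_mat_norm_nonneg) simp

lemma balanced_decomp_zero:
  assumes "cvs.subspace V" "cvs.subspace W"
  shows "balanced_decomp V W p (\<lambda>_ _. 0) 0"
proof -
  have "scalar_mat_norm m n (\<lambda>_ _. 0) = 0" for m n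
    by (intro antisym mat_opnorm_leI scalar_mat_norm_nonneg) simp_all
  then show ?thesis
    unfolding balanced_decomp_def using assms
    by (intro exI[of _ 1] exI[of _ "\<lambda>_ _. 0"]) (simp add: schur_product_def mats_def cvs.subspace_0 op_mat_norm_zero)
qed

text \<open>Stacking \<open>\<alpha>\<close>'s side by side and \<open>\<beta>\<close>'s on top of each other over direct sums of the \<open>x\<close>'s and
  \<open>y\<close>'s: the squares of the scalar norms add up, while the norm of a direct sum is a maximum.
  This makes the balanced bounds additive.\<close>

lemma balanced_decomp_add:
  assumes V: "cvs.subspace V" and W: "cvs.subspace W"
    and "balanced_decomp V W p u a" and "balanced_decomp V W p v b"
  shows "balanced_decomp V W p (\<lambda>i j. u i j + v i j) (a + b)"
proof -
  obtain m \<alpha> x y \<beta> where m: "m \<ge> 1" "x \<in> mats m V" "y \<in> mats m W"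
    "op_mat_norm m x \<le> 1" "op_mat_norm m y \<le> 1"
    "(scalar_mat_norm p m \<alpha>)\<^sup>2 \<le> a" "(scalar_mat_norm m p \<beta>)\<^sup>2 \<le> a"
    and u: "\<forall>i<p. \<forall>j<p. u i j = schur_product m \<alpha> x y \<beta> i j"
    using assms(3) unfolding balanced_decomp_def by blast
  obtain n \<alpha>' x' y' \<beta>' where n: "n \<ge> 1" "x' \<in> mats n V" "y' \<in> mats n W"
    "op_mat_norm n x' \<le> 1" "op_mat_norm n y' \<le> 1"
    "(scalar_mat_norm p n \<alpha>')\<^sup>2 \<le> b" "(scalar_mat_norm n p \<beta>')\<^sup>2 \<le> b"
    and v: "\<forall>i<p. \<forall>j<p. v i j = schur_product n \<alpha>' x' y' \<beta>' i j"
    using assms(4) unfolding balanced_decomp_def by blast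
  let ?\<alpha> = "\<lambda>i k. if k < m then \<alpha> i k else \<alpha>' i (k - m)"
  let ?\<beta> = "\<lambda>l j. if l < m then \<beta> l j else \<beta>' (l - m) j"
  let ?x = "direct_sum_mat m x x'" and ?y = "direct_sum_mat m y y'"
  have zero: "0 \<otimes> w = 0" for w :: "'b \<Rightarrow>\<^sub>L 'b"
    using tensor_scaleC_left[of 0 0 w] by simp
  have "schur_product (m + n) ?\<alpha> ?x ?y ?\<beta> i j =
      schur_product m \<alpha> x y \<beta> i j + schur_product n \<alpha>' x' y' \<beta>' i j" for i j
    by (simp add: schur_product_def sum_lessThan_add direct_sum_mat_simps zero)
  with u v have "\<forall>i<p. \<forall>j<p. u i j + v i j = schur_product (m + n) ?\<alpha> ?x ?y ?\<beta> i j" by simp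
  moreover have "?x \<in> mats (m + n) V" "?y \<in> mats (m + n) W"
    using m n V W by (simp_all add: direct_sum_mat_mats cvs.subspace_0)
  ultimately show ?thesis
    unfolding balanced_decomp_def using m(1)
      op_mat_norm_direct_sum_le_1[OF m(4) n(4)] op_mat_norm_direct_sum_le_1[OF m(5) n(5)]
      scalar_mat_norm_append_columns[OF m(6) n(6)] scalar_mat_norm_append_rows[OF m(7) n(7)]
    by (intro exI[of _ "m + n"] exI[of _ ?\<alpha>] exI[of _ ?x] exI[of _ ?y] exI[of _ ?\<beta>]) simp
qed

text \<open>A square root of \<open>z\<close> goes to each of the two scalar factors, which keeps them balanced.\<close>

lemma balanced_decomp_scale:
  assumes "balanced_decomp V W p u c"
  shows "balanced_decomp V W p (\<lambda>i j. z *\<^sub>C u i j) (cmod z * c)"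
proof -
  obtain n \<alpha> x y \<beta> where n: "n \<ge> 1" "x \<in> mats n V" "y \<in> mats n W"
    "op_mat_norm n x \<le> 1" "op_mat_norm n y \<le> 1"
    and a: "(scalar_mat_norm p n \<alpha>)\<^sup>2 \<le> c" and b: "(scalar_mat_norm n p \<beta>)\<^sup>2 \<le> c"
    and u: "\<forall>i<p. \<forall>j<p. u i j = schur_product n \<alpha> x y \<beta> i j"
    using assms unfolding balanced_decomp_def by blast
  have sq: "(cmod (csqrt z))\<^sup>2 = cmod z" by (simp add: norm_power[symmetric])
  have "(scalar_mat_norm p n (\<lambda>i k. csqrt z * \<alpha> i k))\<^sup>2 \<le> (cmod (csqrt z) * scalar_mat_norm p n \<alpha>)\<^sup>2"
    by (intro power_mono scalar_mat_norm_scale scalar_mat_norm_nonneg)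
  also have "\<dots> \<le> cmod z * c" using a by (simp add: power_mult_distrib sq mult_left_mono)
  finally have a': "(scalar_mat_norm p n (\<lambda>i k. csqrt z * \<alpha> i k))\<^sup>2 \<le> cmod z * c" .
  have "(scalar_mat_norm n p (\<lambda>l j. csqrt z * \<beta> l j))\<^sup>2 \<le> (cmod (csqrt z) * scalar_mat_norm n p \<beta>)\<^sup>2"
    by (intro power_mono scalar_mat_norm_scale scalar_mat_norm_nonneg)
  also have "\<dots> \<le> cmod z * c" using b by (simp add: power_mult_distrib sq mult_left_mono)
  finally have b': "(scalar_mat_norm n p (\<lambda>l j. csqrt z * \<beta> l j))\<^sup>2 \<le> cmod z * c" .
  have root: "csqrt z * a * (csqrt z * b) = z * (a * b)" for a b
  proof -
    have "csqrt z * a * (csqrt z * b) = (csqrt z)\<^sup>2 * (a * b)"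
      by (simp only: power2_eq_square ac_simps)
    then show ?thesis by simp
  qed
  have "schur_product n (\<lambda>i k. csqrt z * \<alpha> i k) x y (\<lambda>l j. csqrt z * \<beta> l j) i j =
      z *\<^sub>C schur_product n \<alpha> x y \<beta> i j" for i j
    by (simp add: schur_product_def cvs.scale_sum_right scaleC_scaleC root)
  with u have "\<forall>i<p. \<forall>j<p. z *\<^sub>C u i j =
      schur_product n (\<lambda>i k. csqrt z * \<alpha> i k) x y (\<lambda>l j. csqrt z * \<beta> l j) i j" by simp
  with n a' b' show ?thesis
    unfolding balanced_decomp_def by blast
qed

lemma balanced_decomp_sum:
  assumes "cvs.subspace V" "cvs.subspace W" and "finite A"
    and "\<And>a. a \<in> A \<Longrightarrow> balanced_decomp V W p (u a) (c a)"
  shows "balanced_decomp V W p (\<lambda>i j. \<Sum>a\<in>A. u a i j) (\<Sum>a\<in>A. c a)"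
  using assms(3,4)
proof (induction A rule: finite_induct)
  case empty
  then show ?case by (simp add: balanced_decomp_zero[OF assms(1,2)])
next
  case (insert a A)
  then show ?case by (simp add: balanced_decomp_add[OF assms(1,2)])
qed

text \<open>Only row \<open>i\<close> of \<open>\<alpha>\<close> and column \<open>j\<close> of \<open>\<beta>\<close> are nonzero.\<close>

lemma balanced_decomp_matrix_unit:
  assumes "balanced_decomp V W 1 (\<lambda>_ _. t) c"
  shows "balanced_decomp V W p (\<lambda>r s. if r = i \<and> s = j then t else 0) c"
proof -
  obtain n \<alpha> x y \<beta> where n: "n \<ge> 1" "x \<in> mats n V" "y \<in> mats n W"
    "op_mat_norm n x \<le> 1" "op_mat_norm n y \<le> 1"
    and a: "(scalar_mat_norm 1 n \<alpha>)\<^sup>2 \<le> c" and b: "(scalar_mat_norm n 1 \<beta>)\<^sup>2 \<le> c"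
    and t: "t = schur_product n \<alpha> x y \<beta> 0 0"
    using assms unfolding balanced_decomp_def by fastforce
  let ?\<alpha> = "\<lambda>r k. if r = i then \<alpha> 0 k else 0" and ?\<beta> = "\<lambda>l s. if s = j then \<beta> l 0 else 0"
  have "scalar_mat_norm p n ?\<alpha> \<le> scalar_mat_norm 1 n \<alpha>"
  proof (rule mat_opnorm_leI[OF scalar_mat_norm_nonneg])
    fix \<xi> :: "nat \<Rightarrow> complex"
    have "(\<Sum>r<p. (cmod (\<Sum>k<n. ?\<alpha> r k * \<xi> k))\<^sup>2) =
        (\<Sum>r<p. if r = i then (cmod (\<Sum>k<n. \<alpha> 0 k * \<xi> k))\<^sup>2 else 0)"
      by (intro sum.cong) auto
    also have "\<dots> \<le> (\<Sum>r<1. (cmod (\<Sum>k<n. \<alpha> r k * \<xi> k))\<^sup>2)" by simp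
    also have "\<dots> \<le> (scalar_mat_norm 1 n \<alpha>)\<^sup>2 * (\<Sum>j<n. (cmod (\<xi> j))\<^sup>2)"
      by (rule scalar_mat_norm_apply_squared)
    finally show "(\<Sum>r<p. (cmod (\<Sum>k<n. ?\<alpha> r k * \<xi> k))\<^sup>2) \<le> \<dots>" .
  qed
  then have a': "(scalar_mat_norm p n ?\<alpha>)\<^sup>2 \<le> c"
    using a by (meson order_trans power_mono scalar_mat_norm_nonneg)
  have "scalar_mat_norm n p ?\<beta> \<le> scalar_mat_norm n 1 \<beta>"
  proof (rule mat_opnorm_leI[OF scalar_mat_norm_nonneg])
    fix \<xi> :: "nat \<Rightarrow> complex"
    \<comment> \<open>an index \<open>j \<ge> p\<close> lies outside the format, and then the matrix vanishes\<close>
    define \<zeta> where "\<zeta> = (if j < p then \<xi> j else 0)"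
    have "(\<Sum>s<p. ?\<beta> l s * \<xi> s) = (\<Sum>s<1. \<beta> l s * \<zeta>)" for l
      by (simp add: \<zeta>_def if_distrib[of "\<lambda>c. c * _"] cong: if_cong)
    then have "(\<Sum>l<n. (cmod (\<Sum>s<p. ?\<beta> l s * \<xi> s))\<^sup>2) =
        (\<Sum>l<n. (cmod (\<Sum>s<1. \<beta> l s * \<zeta>))\<^sup>2)" by simp
    also have "\<dots> \<le> (scalar_mat_norm n 1 \<beta>)\<^sup>2 * (\<Sum>s<1::nat. (cmod \<zeta>)\<^sup>2)"
      by (rule scalar_mat_norm_apply_squared[where \<xi>="\<lambda>_::nat. \<zeta>"])
    also have "\<dots> \<le> (scalar_mat_norm n 1 \<beta>)\<^sup>2 * (\<Sum>s<p. (cmod (\<xi> s))\<^sup>2)"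
      using member_le_sum[of j "{..<p}" "\<lambda>s. (cmod (\<xi> s))\<^sup>2"]
      by (intro mult_left_mono) (auto simp: \<zeta>_def sum_nonneg)
    finally show "(\<Sum>l<n. (cmod (\<Sum>s<p. ?\<beta> l s * \<xi> s))\<^sup>2) \<le> \<dots>" .
  qed
  then have b': "(scalar_mat_norm n p ?\<beta>)\<^sup>2 \<le> c"
    using b by (meson order_trans power_mono scalar_mat_norm_nonneg)
  have "(if r = i \<and> s = j then t else 0) = schur_product n ?\<alpha> x y ?\<beta> r s" for r s
    by (auto simp: t schur_product_def)
  with n a' b' show ?thesis
    unfolding balanced_decomp_def
    by (intro exI[of _ n] exI[of _ ?\<alpha>] exI[of _ x] exI[of _ y] exI[of _ ?\<beta>]) simp
qed

lemma balanced_decomp_entries: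
  assumes "cvs.subspace V" "cvs.subspace W"
    and "\<And>i j. i < p \<Longrightarrow> j < p \<Longrightarrow> balanced_decomp V W 1 (\<lambda>_ _. u i j) (c i j)"
  shows "balanced_decomp V W p u (\<Sum>i<p. \<Sum>j<p. c i j)"
proof -
  let ?A = "{..<p} \<times> {..<p}"
  have "balanced_decomp V W p
      (\<lambda>r s. \<Sum>a\<in>?A. if r = fst a \<and> s = snd a then u (fst a) (snd a) else 0)
      (\<Sum>a\<in>?A. c (fst a) (snd a))"
    using assms(3) by (intro balanced_decomp_sum assms(1,2) balanced_decomp_matrix_unit) auto
  also have "(\<Sum>a\<in>?A. c (fst a) (snd a)) = (\<Sum>i<p. \<Sum>j<p. c i j)"
    by (simp add: sum.cartesian_product case_prod_beta)
  also have "balanced_decomp V W p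
      (\<lambda>r s. \<Sum>a\<in>?A. if r = fst a \<and> s = snd a then u (fst a) (snd a) else 0)
      (\<Sum>i<p. \<Sum>j<p. c i j) \<longleftrightarrow> balanced_decomp V W p u (\<Sum>i<p. \<Sum>j<p. c i j)"
  proof (rule balanced_decomp_cong)
    fix r s assume rs: "r < p" "s < p"
    have "(\<Sum>a\<in>?A. if r = fst a \<and> s = snd a then u (fst a) (snd a) else 0) =
        (\<Sum>a\<in>?A. if a = (r, s) then u r s else 0)"
      by (intro sum.cong refl) auto
    then show "(\<Sum>a\<in>?A. if r = fst a \<and> s = snd a then u (fst a) (snd a) else 0) = u r s"
      using rs by simp
  qed
  finally show ?thesis .
qed

lemma balanced_decomp_exists_elem:
  assumes V: "cvs.subspace V" and W: "cvs.subspace W" and "t \<in> tensor_space V W"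
  shows "\<exists>c. balanced_decomp V W 1 (\<lambda>_ _. t) c"
proof -
  have "cvs.subspace {t. \<exists>c. balanced_decomp V W 1 (\<lambda>_ _. t) c}" (is "cvs.subspace ?S")
  proof (rule cvs.subspaceI)
    show "0 \<in> ?S" using balanced_decomp_zero[OF V W] by blast
    show "s + t \<in> ?S" if "s \<in> ?S" "t \<in> ?S" for s t
      using that balanced_decomp_add[OF V W, of 1 "\<lambda>_ _. s" _ "\<lambda>_ _. t"] by blast
    show "z *\<^sub>C t \<in> ?S" if "t \<in> ?S" for z t
      using that balanced_decomp_scale[of V W 1 "\<lambda>_ _. t" _ z] by blast
  qed
  moreover have "\<exists>c. balanced_decomp V W 1 (\<lambda>_ _. v \<otimes> w) c" if "v \<in> V" "w \<in> W" for v w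
  proof (rule exI, rule balanced_decomp_of_product_less[OF V W])
    show "(\<lambda>_ _. v) \<in> mats 1 V" "(\<lambda>_ _. w) \<in> mats 1 W" using that by (simp_all add: mats_def)
    show "v \<otimes> w = schur_product 1 (\<lambda>_ _. 1) (\<lambda>_ _. v) (\<lambda>_ _. w) (\<lambda>_ _. 1) i j" for i j :: nat
      by (simp add: schur_product_def scaleC_one)
  qed (rule order_refl less_add_one)+
  ultimately have "cvs.span {v \<otimes> w | v w. v \<in> V \<and> w \<in> W} \<subseteq>
      {t. \<exists>c. balanced_decomp V W 1 (\<lambda>_ _. t) c}"
    by (intro cvs.span_minimal) auto
  with assms(3) show ?thesis by (auto simp: tensor_space_def)
qed

lemma balanced_decomp_exists:
  assumes V: "cvs.subspace V" and W: "cvs.subspace W" and u: "u \<in> mats p (tensor_space V W)"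
  shows "\<exists>c. balanced_decomp V W p u c"
proof -
  have "\<forall>i j. \<exists>c. i < p \<longrightarrow> j < p \<longrightarrow> balanced_decomp V W 1 (\<lambda>_ _. u i j) c"
    using u balanced_decomp_exists_elem[OF V W] by (auto simp: mats_def)
  then obtain c where "\<And>i j. i < p \<Longrightarrow> j < p \<Longrightarrow> balanced_decomp V W 1 (\<lambda>_ _. u i j) (c i j)"
    by metis
  then have "balanced_decomp V W p u (\<Sum>i<p. \<Sum>j<p. c i j)"
    by (rule balanced_decomp_entries[OF V W])
  then show ?thesis by blast
qed

lemma balanced_decomp_of_schur_norm_less:
  assumes V: "cvs.subspace V" and W: "cvs.subspace W" and u: "u \<in> mats p (tensor_space V W)"
    and "schur_norm V W p u < c"
  shows "balanced_decomp V W p u c"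
proof -
  obtain n \<alpha> x y \<beta> where "n \<ge> 1" "x \<in> mats n V" "y \<in> mats n W"
    "\<forall>i<p. \<forall>j<p. u i j = schur_product n \<alpha> x y \<beta> i j"
    using balanced_decomp_exists[OF V W u] unfolding balanced_decomp_def by blast
  then have "{scalar_mat_norm p n \<alpha> * op_mat_norm n x * op_mat_norm n y * scalar_mat_norm n p \<beta>
     | n \<alpha> x y \<beta>. n \<ge> 1 \<and> x \<in> mats n V \<and> y \<in> mats n W \<and>
         (\<forall>i<p. \<forall>j<p. u i j = (\<Sum>k<n. \<Sum>l<n. (\<alpha> i k * \<beta> l j) *\<^sub>C (x k l \<otimes> y k l)))} \<noteq> {}"
    unfolding schur_product_def by blast
  from cInf_lessD[OF this assms(4)[unfolded schur_norm_def]]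
  obtain n \<alpha> x y \<beta> where "n \<ge> 1" "x \<in> mats n V" "y \<in> mats n W"
    "\<forall>i<p. \<forall>j<p. u i j = (\<Sum>k<n. \<Sum>l<n. (\<alpha> i k * \<beta> l j) *\<^sub>C (x k l \<otimes> y k l))"
    "scalar_mat_norm p n \<alpha> * op_mat_norm n x * op_mat_norm n y * scalar_mat_norm n p \<beta> < c"
    by blast
  then show ?thesis
    by (intro balanced_decomp_of_product_less[OF V W, of n x y p u \<alpha> \<beta>]) (simp_all add: schur_product_def)
qed

lemma schur_norm_nonneg:
  assumes "cvs.subspace V" "cvs.subspace W" "u \<in> mats p (tensor_space V W)"
  shows "0 \<le> schur_norm V W p u"
proof (rule field_le_epsilon)
  fix e :: real assume "0 < e"
  then have "balanced_decomp V W p u (schur_norm V W p u + e)"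
    using assms by (intro balanced_decomp_of_schur_norm_less) simp_all
  then show "0 \<le> schur_norm V W p u + e"
    unfolding balanced_decomp_def by (meson order_trans zero_le_power2)
qed

lemma schur_norm_matrix_seminorm:
  assumes V: "cvs.subspace V" and W: "cvs.subspace W"
  shows "matrix_seminorm (tensor_space V W) (schur_norm V W)"
proof
  show "cvs.subspace (tensor_space V W)"
    by (simp add: tensor_space_def cvs.subspace_span)
next
  fix u n assume u: "u \<in> mats n (tensor_space V W)"
  note decomp = balanced_decomp_of_schur_norm_less[OF V W]
  show "0 \<le> schur_norm V W n u" by (rule schur_norm_nonneg[OF V W u])
  show "schur_norm V W n (\<lambda>i j. u i j + v i j) \<le> schur_norm V W n u + schur_norm V W n v"
    if v: "v \<in> mats n (tensor_space V W)" for v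
  proof (rule le_of_le_add_mult_epsilon[of 2])
    fix e :: real assume e: "0 < e"
    have "balanced_decomp V W n (\<lambda>i j. u i j + v i j)
        ((schur_norm V W n u + e) + (schur_norm V W n v + e))"
      using e by (intro balanced_decomp_add V W decomp u v) simp_all
    from schur_norm_le_balanced[OF this]
    show "schur_norm V W n (\<lambda>i j. u i j + v i j) \<le> schur_norm V W n u + schur_norm V W n v + 2 * e"
      by simp
  qed simp
  show "schur_norm V W n (\<lambda>i j. c *\<^sub>C u i j) \<le> cmod c * schur_norm V W n u" for c
  proof (rule le_of_le_add_mult_epsilon[of "cmod c"])
    fix e :: real assume e: "0 < e"
    have "balanced_decomp V W n (\<lambda>i j. c *\<^sub>C u i j) (cmod c * (schur_norm V W n u + e))"
      using e by (intro balanced_decomp_scale decomp u) simp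
    from schur_norm_le_balanced[OF this]
    show "schur_norm V W n (\<lambda>i j. c *\<^sub>C u i j) \<le> cmod c * schur_norm V W n u + cmod c * e"
      by (simp add: distrib_left)
  qed simp
  show "schur_norm V W n u \<le> (\<Sum>i<n. \<Sum>j<n. schur_norm V W 1 (\<lambda>_ _. u i j))"
  proof (rule le_of_le_add_mult_epsilon[of "real n * real n"])
    fix e :: real assume e: "0 < e"
    have "balanced_decomp V W n u (\<Sum>i<n. \<Sum>j<n. schur_norm V W 1 (\<lambda>_ _. u i j) + e)"
      using e u by (intro balanced_decomp_entries V W decomp) (auto simp: mats_def)
    from schur_norm_le_balanced[OF this]
    show "schur_norm V W n u \<le> (\<Sum>i<n. \<Sum>j<n. schur_norm V W 1 (\<lambda>_ _. u i j)) + real n * real n * e"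
      by (simp add: sum.distrib algebra_simps)
  qed simp
qed

lemma schur_norm_tensor_le:
  assumes "n \<ge> 1" "x \<in> mats n V" "y \<in> mats n W"
  shows "schur_norm V W n (\<lambda>i j. x i j \<otimes> y i j) \<le> op_mat_norm n x * op_mat_norm n y"
proof (rule schur_norm_le[OF assms])
  let ?I = "\<lambda>i k. if i = k then 1 else 0 :: complex"
  show "x i j \<otimes> y i j = schur_product n ?I x y ?I i j" if "i < n" "j < n" for i j
  proof -
    have "(\<Sum>l<n. (?I i k * ?I l j) *\<^sub>C (x k l \<otimes> y k l)) =
        (\<Sum>l<n. if l = j then ?I i k *\<^sub>C (x k j \<otimes> y k j) else 0)" for k
      by (intro sum.cong) auto
    then have "schur_product n ?I x y ?I i j = (\<Sum>k<n. if k = i then x i j \<otimes> y i j else 0)"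
      unfolding schur_product_def using that by (intro sum.cong) (auto simp: scaleC_one)
    then show ?thesis using that by simp
  qed
  have "scalar_mat_norm n n ?I * op_mat_norm n x * op_mat_norm n y * scalar_mat_norm n n ?I \<le>
      1 * op_mat_norm n x * op_mat_norm n y * 1"
    by (intro mult_mono scalar_mat_norm_identity_le_1 order_refl mult_nonneg_nonneg
        scalar_mat_norm_nonneg op_mat_norm_nonneg) simp_all
  then show "scalar_mat_norm n n ?I * op_mat_norm n x * op_mat_norm n y * scalar_mat_norm n n ?I \<le>
      op_mat_norm n x * op_mat_norm n y" by simp
qed

text \<open>A linear map carries \<open>\<alpha>(x \<circ> y)\<beta>\<close> to \<open>\<alpha>\<phi>\<^sub>n(x, y)\<beta>\<close>, so a schur bound of the bilinear map
  \<open>\<phi>\<close> bounds the linear map for the schur norms with the same constant.\<close>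

lemma linear_bound_of_schur_bound:
  fixes L :: "('h::chilbert_space \<Rightarrow>\<^sub>L 'h, 'k::chilbert_space \<Rightarrow>\<^sub>L 'k) tensor \<Rightarrow>
    ('l::chilbert_space \<Rightarrow>\<^sub>L 'l)"
  assumes V: "cvs.subspace V" and W: "cvs.subspace W"
    and L: "Vector_Spaces.linear scaleC scaleC L"
    and ops: "\<And>v w. v \<in> V \<Longrightarrow> w \<in> W \<Longrightarrow> L (v \<otimes> w) \<in> bounded_ops"
    and C: "0 \<le> C" "\<And>n x y. n \<ge> 1 \<Longrightarrow> x \<in> mats n V \<Longrightarrow> y \<in> mats n W \<Longrightarrow>
          op_mat_norm n (\<lambda>i j. L (x i j \<otimes> y i j)) \<le> C * op_mat_norm n x * op_mat_norm n y"
    and u: "u \<in> mats p (tensor_space V W)"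
  shows "op_mat_norm p (\<lambda>i j. L (u i j)) \<le> C * schur_norm V W p u"
proof (rule le_of_le_add_mult_epsilon[OF C(1)])
  interpret L: Vector_Spaces.linear scaleC scaleC L by fact
  fix e :: real assume "0 < e"
  define c where "c = schur_norm V W p u + e"
  have "balanced_decomp V W p u c"
    using \<open>0 < e\<close> by (intro balanced_decomp_of_schur_norm_less V W u) (simp add: c_def)
  then obtain n \<alpha> x y \<beta> where n: "n \<ge> 1" and x: "x \<in> mats n V" and y: "y \<in> mats n W"
    and x1: "op_mat_norm n x \<le> 1" and y1: "op_mat_norm n y \<le> 1"
    and a: "(scalar_mat_norm p n \<alpha>)\<^sup>2 \<le> c" and b: "(scalar_mat_norm n p \<beta>)\<^sup>2 \<le> c"
    and u: "\<And>i j. i < p \<Longrightarrow> j < p \<Longrightarrow> u i j = schur_product n \<alpha> x y \<beta> i j"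
    unfolding balanced_decomp_def by blast
  let ?z = "\<lambda>k l. L (x k l \<otimes> y k l)"
  have c: "0 \<le> c" using a by (meson order_trans zero_le_power2)
  have "op_mat_norm p (\<lambda>i j. L (u i j)) =
      op_mat_norm p (\<lambda>i j. \<Sum>k<n. \<Sum>l<n. (\<alpha> i k * \<beta> l j) *\<^sub>C ?z k l)"
    by (rule mat_opnorm_cong) (simp add: u schur_product_def L.sum L.scale)
  also have "\<dots> \<le> scalar_mat_norm p n \<alpha> * op_mat_norm n ?z * scalar_mat_norm n p \<beta>"
    using x y by (intro op_mat_norm_scalar_products) (simp add: mats_def ops)
  also have "\<dots> \<le> sqrt c * C * sqrt c"
  proof -
    have "op_mat_norm n ?z \<le> C * op_mat_norm n x * op_mat_norm n y" by (rule C(2)[OF n x y])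
    also have "\<dots> \<le> C * 1 * 1"
      by (intro mult_mono order_refl x1 y1 mult_nonneg_nonneg op_mat_norm_nonneg C) simp_all
    finally have "op_mat_norm n ?z \<le> C" by simp
    then show ?thesis
      by (intro mult_mono real_le_rsqrt a b mult_nonneg_nonneg scalar_mat_norm_nonneg
          op_mat_norm_nonneg) (use c C in simp_all)
  qed
  also have "\<dots> = C * schur_norm V W p u + C * e"
    using c by (simp add: c_def algebra_simps)
  finally show "op_mat_norm p (\<lambda>i j. L (u i j)) \<le> C * schur_norm V W p u + C * e" .
qed

section \<open>Schur bounded bilinear maps and completely bounded maps\<close>

lemma nested_SUP_upper:
  fixes f :: "'i \<Rightarrow> 'x \<Rightarrow> real"
  assumes "\<And>i x. i \<in> I \<Longrightarrow> x \<in> S i \<Longrightarrow> f i x \<le> C" and "\<And>i. i \<in> I \<Longrightarrow> S i \<noteq> {}"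
    and "i \<in> I" "x \<in> S i"
  shows "f i x \<le> (SUP i\<in>I. SUP x\<in>S i. f i x)"
proof (rule cSUP_upper2)
  show "bdd_above ((\<lambda>i. SUP x\<in>S i. f i x) ` I)"
    using assms(1,2) by (intro bdd_aboveI2[of _ _ C] cSUP_least)
  show "f i x \<le> (SUP x\<in>S i. f i x)"
    using assms by (intro cSUP_upper bdd_aboveI2[of _ _ C])
qed fact

lemma opspace_simps [simp]:
  "pts (opspace V) = V" "add (opspace V) = (+)" "scl (opspace V) = scaleC"
  "mnorm (opspace V) = op_mat_norm"
  by (simp_all add: opspace_def)

text \<open>The norm \<open>sb_norm\<close> is a supremum over unit balls; by homogeneity it is a bound everywhere. When the
  norm of \<open>x\<close> or \<open>y\<close> vanishes there is no rescaling into the unit ball, and any schur bound \<open>C\<close> shows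
  that the left side is zero.\<close>

lemma SB_bound:
  assumes V: "cvs.subspace V" and W: "cvs.subspace W"
    and \<phi>: "\<phi> \<in> SB (opspace V) (opspace W) (opspace X)"
  shows "0 \<le> sb_norm (opspace V) (opspace W) (opspace X) \<phi>" (is "0 \<le> ?s")
    and "n \<ge> 1 \<Longrightarrow> x \<in> mats n V \<Longrightarrow> y \<in> mats n W \<Longrightarrow>
      op_mat_norm n (\<lambda>i j. \<phi> (x i j, y i j)) \<le>
        sb_norm (opspace V) (opspace W) (opspace X) \<phi> * op_mat_norm n x * op_mat_norm n y"
proof -
  obtain C where C: "\<And>n v w. n \<ge> 1 \<Longrightarrow> v \<in> mats n V \<Longrightarrow> w \<in> mats n W \<Longrightarrow>
      op_mat_norm n (\<lambda>i j. \<phi> (v i j, w i j)) \<le> C * op_mat_norm n v * op_mat_norm n w"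
    using \<phi> by (auto simp: SB_def)
  let ?BV = "\<lambda>n. {v \<in> mats n V. op_mat_norm n v \<le> 1}"
  let ?BW = "\<lambda>n. {w \<in> mats n W. op_mat_norm n w \<le> 1}"
  have zero: "(\<lambda>_ _. 0) \<in> ?BV n" "(\<lambda>_ _. 0) \<in> ?BW n" for n
    using V W by (simp_all add: mats_def cvs.subspace_0 op_mat_norm_zero)
  have unit: "op_mat_norm n (\<lambda>i j. \<phi> (v i j, w i j)) \<le> ?s"
    if n: "n \<ge> 1" and v: "v \<in> ?BV n" and w: "w \<in> ?BW n" for n v w
  proof -
    let ?f = "\<lambda>n (v, w). op_mat_norm n (\<lambda>i j. \<phi> (v i j, w i j))"
    have "?f n (v, w) \<le> (SUP n\<in>{1..}. SUP p\<in>?BV n \<times> ?BW n. ?f n p)"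
    proof (rule nested_SUP_upper[of "{1..}" "\<lambda>n. ?BV n \<times> ?BW n" ?f "\<bar>C\<bar>"])
      fix n p assume n: "n \<in> {1::nat..}" and p: "p \<in> ?BV n \<times> ?BW n"
      obtain v w where vw: "p = (v, w)" by (cases p)
      have "op_mat_norm n (\<lambda>i j. \<phi> (v i j, w i j)) \<le> C * op_mat_norm n v * op_mat_norm n w"
        using C n p vw by simp
      also have "\<dots> \<le> \<bar>C\<bar> * 1 * 1"
        using p vw by (intro mult_mono mult_nonneg_nonneg op_mat_norm_nonneg) auto
      finally show "?f n p \<le> \<bar>C\<bar>" by (simp add: vw)
    qed (use zero n v w in blast)+
    then show ?thesis by (simp add: sb_norm_def)
  qed
  show s: "0 \<le> ?s"
    by (rule order_trans[OF op_mat_norm_nonneg unit[OF _ zero, of 1]]) simp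
  assume n: "n \<ge> 1" and x: "x \<in> mats n V" and y: "y \<in> mats n W"
  define a b where "a = op_mat_norm n x" and "b = op_mat_norm n y"
  have ab0: "0 \<le> a" "0 \<le> b" by (simp_all add: a_def b_def op_mat_norm_nonneg)
  show "op_mat_norm n (\<lambda>i j. \<phi> (x i j, y i j)) \<le> ?s * op_mat_norm n x * op_mat_norm n y"
  proof (cases "a = 0 \<or> b = 0")
    case True
    then show ?thesis using C[OF n x y] by (auto simp: a_def b_def)
  next
    case False
    with ab0 have ab: "0 < a" "0 < b" by simp_all
    let ?x = "\<lambda>i j. complex_of_real (1 / a) *\<^sub>C x i j" and ?y = "\<lambda>i j. complex_of_real (1 / b) *\<^sub>C y i j"
    have m: "?x \<in> mats n V" "?y \<in> mats n W"
      using x y cvs.subspace_scale[OF V] cvs.subspace_scale[OF W] by (auto simp: mats_def)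
    have "op_mat_norm n ?x \<le> cmod (complex_of_real (1 / a)) * a"
      unfolding a_def by (rule op_mat_norm_scale)
    then have "?x \<in> ?BV n" using ab m by (simp add: norm_divide)
    moreover have "op_mat_norm n ?y \<le> cmod (complex_of_real (1 / b)) * b"
      unfolding b_def by (rule op_mat_norm_scale)
    then have "?y \<in> ?BW n" using ab m by (simp add: norm_divide)
    ultimately have le: "op_mat_norm n (\<lambda>i j. \<phi> (?x i j, ?y i j)) \<le> ?s" by (rule unit[OF n])
    have "\<phi> (x i j, y i j) = complex_of_real (a * b) *\<^sub>C \<phi> (?x i j, ?y i j)" if "i < n" "j < n" for i j
    proof -
      have xy: "x i j \<in> V" "y i j \<in> W" "?y i j \<in> W" using x y m that by (simp_all add: mats_def)
      have "\<phi> (?x i j, ?y i j) = complex_of_real (1 / a) *\<^sub>C complex_of_real (1 / b) *\<^sub>C \<phi> (x i j, y i j)"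
        using \<phi> xy by (simp add: SB_def bilinear_map_def)
      then show ?thesis using ab by (simp add: scaleC_scaleC scaleC_one)
    qed
    then have "op_mat_norm n (\<lambda>i j. \<phi> (x i j, y i j)) =
        op_mat_norm n (\<lambda>i j. complex_of_real (a * b) *\<^sub>C \<phi> (?x i j, ?y i j))"
      by (intro mat_opnorm_cong)
    also have "\<dots> \<le> cmod (complex_of_real (a * b)) * op_mat_norm n (\<lambda>i j. \<phi> (?x i j, ?y i j))"
      by (rule op_mat_norm_scale)
    also have "\<dots> = a * b * op_mat_norm n (\<lambda>i j. \<phi> (?x i j, ?y i j))"
      using ab by (simp only: norm_of_real abs_of_pos mult_pos_pos)
    also have "\<dots> \<le> a * b * ?s" using le ab by (intro mult_left_mono) simp_all
    finally show ?thesis by (simp add: a_def b_def ac_simps)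
  qed
qed

context
  fixes V :: "('h::chilbert_space \<Rightarrow>\<^sub>L 'h) set"
    and W :: "('k::chilbert_space \<Rightarrow>\<^sub>L 'k) set"
    and X :: "('l::chilbert_space \<Rightarrow>\<^sub>L 'l) set"
  assumes V: "cvs.subspace V" and W: "cvs.subspace W"
begin

interpretation M: matrix_seminorm "tensor_space V W" "schur_norm V W"
  by (rule schur_norm_matrix_seminorm[OF V W])

lemma tensor_in_space: "v \<in> V \<Longrightarrow> w \<in> W \<Longrightarrow> v \<otimes> w \<in> tensor_space V W"
  unfolding tensor_space_def by (rule cvs.span_base) blast

lemma schur_incl_in_pts: "t \<in> tensor_space V W \<Longrightarrow> schur_incl V W t \<in> pts (V \<otimes>\<^sup>s W)"
  unfolding schur_incl_def schur_tensor_def by (rule M.cls_in_pts[OF M.constant_cauchy])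

lemma CB_incl_add:
  assumes "\<psi> \<in> CB (V \<otimes>\<^sup>s W) (opspace X)" "s \<in> tensor_space V W" "t \<in> tensor_space V W"
  shows "\<psi> (schur_incl V W (s + t)) = \<psi> (schur_incl V W s) + \<psi> (schur_incl V W t)"
proof -
  have "schur_incl V W (s + t) = add (V \<otimes>\<^sup>s W) (schur_incl V W s) (schur_incl V W t)"
    unfolding schur_incl_def schur_tensor_def
    by (rule M.add_cls[OF M.constant_cauchy M.constant_cauchy, symmetric]) fact+
  then show ?thesis using assms schur_incl_in_pts by (simp add: CB_def linear_map_def)
qed

lemma CB_incl_scale:
  assumes "\<psi> \<in> CB (V \<otimes>\<^sup>s W) (opspace X)" "t \<in> tensor_space V W"
  shows "\<psi> (schur_incl V W (c *\<^sub>C t)) = c *\<^sub>C \<psi> (schur_incl V W t)"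
proof -
  have "schur_incl V W (c *\<^sub>C t) = scl (V \<otimes>\<^sup>s W) c (schur_incl V W t)"
    unfolding schur_incl_def schur_tensor_def
    by (rule M.scl_cls[OF M.constant_cauchy, symmetric]) fact
  then show ?thesis using assms schur_incl_in_pts by (simp add: CB_def linear_map_def)
qed

lemma schur_incl_mats:
  assumes "x \<in> mats n V" "y \<in> mats n W"
  shows "(\<lambda>i j. schur_incl V W (x i j \<otimes> y i j)) \<in> mats n (pts (V \<otimes>\<^sup>s W))"
  using assms by (simp add: mats_def schur_incl_in_pts tensor_in_space)

lemma mnorm_schur_incl_le:
  assumes "n \<ge> 1" "x \<in> mats n V" "y \<in> mats n W"
  shows "mnorm (V \<otimes>\<^sup>s W) n (\<lambda>i j. schur_incl V W (x i j \<otimes> y i j)) \<le> op_mat_norm n x * op_mat_norm n y"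
proof -
  have "(\<lambda>i j. x i j \<otimes> y i j) \<in> mats n (tensor_space V W)"
    using assms by (simp add: mats_def tensor_in_space)
  from M.mnorm_completion_constants[OF this] schur_norm_tensor_le[OF assms] show ?thesis
    by (simp only: schur_incl_def schur_tensor_def)
qed

lemma assoc_bilinear_apply:
  "v \<in> V \<Longrightarrow> w \<in> W \<Longrightarrow> assoc_bilinear V W \<psi> (v, w) = \<psi> (schur_incl V W (v \<otimes> w))"
  by (simp add: assoc_bilinear_def)

lemma assoc_bilinear_mat:
  assumes "x \<in> mats n V" "y \<in> mats n W"
  shows "op_mat_norm n (\<lambda>i j. assoc_bilinear V W \<psi> (x i j, y i j)) =
           op_mat_norm n (\<lambda>i j. \<psi> (schur_incl V W (x i j \<otimes> y i j)))"
  using assms by (intro mat_opnorm_cong) (simp add: mats_def assoc_bilinear_apply)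

lemma assoc_bilinear_in_SB:
  assumes \<psi>: "\<psi> \<in> CB (V \<otimes>\<^sup>s W) (opspace X)"
  shows "assoc_bilinear V W \<psi> \<in> SB (opspace V) (opspace W) (opspace X)"
proof -
  obtain C where C: "\<And>n x. n \<ge> 1 \<Longrightarrow> x \<in> mats n (pts (V \<otimes>\<^sup>s W)) \<Longrightarrow>
      op_mat_norm n (\<lambda>i j. \<psi> (x i j)) \<le> C * mnorm (V \<otimes>\<^sup>s W) n x"
    using \<psi> by (auto simp: CB_def)
  have "op_mat_norm n (\<lambda>i j. assoc_bilinear V W \<psi> (x i j, y i j)) \<le> \<bar>C\<bar> * op_mat_norm n x * op_mat_norm n y"
    if n: "n \<ge> 1" and x: "x \<in> mats n V" and y: "y \<in> mats n W" for n x y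
  proof -
    note m = schur_incl_mats[OF x y]
    have "op_mat_norm n (\<lambda>i j. assoc_bilinear V W \<psi> (x i j, y i j)) \<le>
        C * mnorm (V \<otimes>\<^sup>s W) n (\<lambda>i j. schur_incl V W (x i j \<otimes> y i j))"
      unfolding assoc_bilinear_mat[OF x y] by (rule C[OF n m])
    also have "\<dots> \<le> \<bar>C\<bar> * mnorm (V \<otimes>\<^sup>s W) n (\<lambda>i j. schur_incl V W (x i j \<otimes> y i j))"
      using M.mnorm_completion_nonneg[OF m[unfolded schur_tensor_def]]
      by (intro mult_right_mono) (simp_all add: schur_tensor_def)
    also have "\<dots> \<le> \<bar>C\<bar> * (op_mat_norm n x * op_mat_norm n y)"
      by (intro mult_left_mono mnorm_schur_incl_le n x y) simp
    finally show ?thesis by (simp add: mult.assoc)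
  qed
  moreover have "bilinear_map (opspace V) (opspace W) (opspace X) (assoc_bilinear V W \<psi>)"
  proof -
    have "assoc_bilinear V W \<psi> \<in> V \<times> W \<rightarrow>\<^sub>E X"
      using \<psi> schur_incl_in_pts[OF tensor_in_space]
      by (auto simp: assoc_bilinear_def CB_def linear_map_def)
    then show ?thesis
      using CB_incl_add[OF \<psi> tensor_in_space tensor_in_space] CB_incl_scale[OF \<psi> tensor_in_space]
        cvs.subspace_add[OF V] cvs.subspace_add[OF W] cvs.subspace_scale[OF V] cvs.subspace_scale[OF W]
      by (simp add: bilinear_map_def assoc_bilinear_apply tensor_add_left tensor_add_right
          tensor_scaleC_left tensor_scaleC_right)
  qed
  ultimately show ?thesis by (auto simp: SB_def)
qed

text \<open>The unit balls of \<open>M\<^sub>n(V)\<close> and \<open>M\<^sub>n(W)\<close> are mapped by \<open>(x, y) \<mapsto> x \<circ> y\<close> into the unit ball of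
  \<open>M\<^sub>n(V \<otimes>\<^sup>s W)\<close>.\<close>

lemma sb_norm_le_cb_norm:
  assumes \<psi>: "\<psi> \<in> CB (V \<otimes>\<^sup>s W) (opspace X)"
  shows "sb_norm (opspace V) (opspace W) (opspace X) (assoc_bilinear V W \<psi>) \<le>
           cb_norm (V \<otimes>\<^sup>s W) (opspace X) \<psi>"
proof -
  obtain C where C: "\<And>n x. n \<ge> 1 \<Longrightarrow> x \<in> mats n (pts (V \<otimes>\<^sup>s W)) \<Longrightarrow>
      op_mat_norm n (\<lambda>i j. \<psi> (x i j)) \<le> C * mnorm (V \<otimes>\<^sup>s W) n x"
    using \<psi> by (auto simp: CB_def)
  let ?B = "\<lambda>n. {x \<in> mats n (pts (V \<otimes>\<^sup>s W)). mnorm (V \<otimes>\<^sup>s W) n x \<le> 1}"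
  let ?BV = "\<lambda>n. {v \<in> mats n V. op_mat_norm n v \<le> 1}"
  let ?BW = "\<lambda>n. {w \<in> mats n W. op_mat_norm n w \<le> 1}"
  have zero: "(\<lambda>_ _. 0) \<in> ?BV n" "(\<lambda>_ _. 0) \<in> ?BW n" for n
    using V W by (simp_all add: mats_def cvs.subspace_0 op_mat_norm_zero)
  have ball: "(\<lambda>i j. schur_incl V W (v i j \<otimes> w i j)) \<in> ?B n"
    if n: "n \<ge> 1" and v: "v \<in> ?BV n" and w: "w \<in> ?BW n" for n v w
  proof -
    have "mnorm (V \<otimes>\<^sup>s W) n (\<lambda>i j. schur_incl V W (v i j \<otimes> w i j)) \<le> op_mat_norm n v * op_mat_norm n w"
      using n v w by (intro mnorm_schur_incl_le) auto
    also have "\<dots> \<le> 1 * 1" using v w by (intro mult_mono op_mat_norm_nonneg) auto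
    finally show ?thesis using v w by (simp add: schur_incl_mats)
  qed
  have unit: "op_mat_norm n (\<lambda>i j. \<psi> (x i j)) \<le> cb_norm (V \<otimes>\<^sup>s W) (opspace X) \<psi>"
    if n: "n \<ge> 1" and x: "x \<in> ?B n" for n x
  proof -
    have "op_mat_norm n (\<lambda>i j. \<psi> (x i j)) \<le> (SUP n\<in>{1..}. SUP x\<in>?B n. op_mat_norm n (\<lambda>i j. \<psi> (x i j)))"
    proof (rule nested_SUP_upper[of "{1..}" ?B "\<lambda>n x. op_mat_norm n (\<lambda>i j. \<psi> (x i j))" "\<bar>C\<bar>"])
      fix n x assume n: "n \<in> {1::nat..}" and x: "x \<in> ?B n"
      have "op_mat_norm n (\<lambda>i j. \<psi> (x i j)) \<le> C * mnorm (V \<otimes>\<^sup>s W) n x" using C n x by simp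
      also have "\<dots> \<le> \<bar>C\<bar> * 1"
        using x M.mnorm_completion_nonneg[of x n]
        by (intro mult_mono) (simp_all add: schur_tensor_def)
      finally show "op_mat_norm n (\<lambda>i j. \<psi> (x i j)) \<le> \<bar>C\<bar>" by simp
    next
      show "?B n \<noteq> {}" if "n \<in> {1..}" for n
        using ball[OF _ zero, of n] that by (auto simp only: atLeast_iff)
    qed (use n x in simp_all)
    then show ?thesis by (simp add: cb_norm_def)
  qed
  show ?thesis
    unfolding sb_norm_def opspace_simps
  proof (intro cSUP_least)
    show "?BV n \<times> ?BW n \<noteq> {}" for n using zero by blast
    fix n p assume n: "n \<in> {1::nat..}" and "p \<in> ?BV n \<times> ?BW n"
    then obtain v w where p: "p = (v, w)" "v \<in> ?BV n" "w \<in> ?BW n" by blast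
    have "op_mat_norm n (\<lambda>i j. assoc_bilinear V W \<psi> (v i j, w i j)) =
        op_mat_norm n (\<lambda>i j. \<psi> (schur_incl V W (v i j \<otimes> w i j)))"
      using p by (intro assoc_bilinear_mat) auto
    also have "\<dots> \<le> cb_norm (V \<otimes>\<^sup>s W) (opspace X) \<psi>"
      using n p by (intro unit ball) auto
    finally show "(case p of (v, w) \<Rightarrow> op_mat_norm n (\<lambda>i j. assoc_bilinear V W \<psi> (v i j, w i j))) \<le>
        cb_norm (V \<otimes>\<^sup>s W) (opspace X) \<psi>" by (simp add: p)
  qed simp
qed

lemma assoc_bilinear_inj: "inj_on (assoc_bilinear V W) (CB (V \<otimes>\<^sup>s W) (opspace X))"
proof (rule inj_onI)
  fix \<psi>1 \<psi>2 assume cb: "\<psi>1 \<in> CB (V \<otimes>\<^sup>s W) (opspace X)" "\<psi>2 \<in> CB (V \<otimes>\<^sup>s W) (opspace X)"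
    and eq: "assoc_bilinear V W \<psi>1 = assoc_bilinear V W \<psi>2"
  let ?E = "{t \<in> tensor_space V W. \<psi>1 (schur_incl V W t) = \<psi>2 (schur_incl V W t)}"
  have "cvs.subspace ?E"
  proof (rule cvs.subspaceI)
    show "0 \<in> ?E"
      using CB_incl_scale[OF cb(1) M.T_zero, of 0] CB_incl_scale[OF cb(2) M.T_zero, of 0]
      by (simp add: M.T_zero)
  qed (simp_all add: CB_incl_add[OF cb(1)] CB_incl_add[OF cb(2)] CB_incl_scale[OF cb(1)]
      CB_incl_scale[OF cb(2)] M.T_add M.T_scale)
  moreover have "v \<otimes> w \<in> ?E" if "v \<in> V" "w \<in> W" for v w
    using eq that assoc_bilinear_apply[of v w \<psi>1] assoc_bilinear_apply[of v w \<psi>2] tensor_in_space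
    by simp
  ultimately have "tensor_space V W \<subseteq> ?E"
    unfolding tensor_space_def by (intro cvs.span_minimal) (auto simp: tensor_space_def[symmetric])
  then have const: "\<psi>1 (schur_incl V W t) = \<psi>2 (schur_incl V W t)" if "t \<in> tensor_space V W" for t
    using that by blast
  show "\<psi>1 = \<psi>2"
  proof (rule PiE_ext)
    show "\<psi>1 \<in> pts (V \<otimes>\<^sup>s W) \<rightarrow>\<^sub>E X" "\<psi>2 \<in> pts (V \<otimes>\<^sup>s W) \<rightarrow>\<^sub>E X"
      using cb by (simp_all add: CB_def linear_map_def)
    fix A assume A: "A \<in> pts (V \<otimes>\<^sup>s W)"
    note A' = A[unfolded schur_tensor_def]
    obtain s where s: "s \<in> A" using M.pts_rep[OF A'] by blast
    have lim: "(\<lambda>k. \<psi> (schur_incl V W (s k))) \<longlonglongrightarrow> \<psi> A" if "\<psi> \<in> CB (V \<otimes>\<^sup>s W) (opspace X)" for \<psi>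
      using that M.bounded_map_tendsto[OF _ _ A' s, of X \<psi>]
      unfolding CB_def schur_tensor_def schur_incl_def by blast
    have "(\<lambda>k. \<psi>1 (schur_incl V W (s k))) = (\<lambda>k. \<psi>2 (schur_incl V W (s k)))"
      using M.cauchy_seqs_in[OF M.pts_mem_cauchy[OF A' s]] by (simp add: const)
    then show "\<psi>1 A = \<psi>2 A" using lim[OF cb(1)] lim[OF cb(2)] LIMSEQ_unique by metis
  qed
qed

text \<open>Linearize on the algebraic tensor product, bound the linear map with the schur bound, and
  extend it to the completion.\<close>

lemma SB_extension:
  assumes X: "operator_space X" and \<phi>: "\<phi> \<in> SB (opspace V) (opspace W) (opspace X)"
  obtains \<psi> where "\<psi> \<in> CB (V \<otimes>\<^sup>s W) (opspace X)" "assoc_bilinear V W \<psi> = \<phi>"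
    and "\<And>n a. n \<ge> 1 \<Longrightarrow> a \<in> mats n (pts (V \<otimes>\<^sup>s W)) \<Longrightarrow> op_mat_norm n (\<lambda>i j. \<psi> (a i j)) \<le>
           sb_norm (opspace V) (opspace W) (opspace X) \<phi> * mnorm (V \<otimes>\<^sup>s W) n a"
proof -
  let ?s = "sb_norm (opspace V) (opspace W) (opspace X) \<phi>"
  have bil: "bilinear_map (opspace V) (opspace W) (opspace X) \<phi>" using \<phi> by (simp add: SB_def)
  have "\<exists>L. Vector_Spaces.linear scaleC scaleC L \<and> (\<forall>v\<in>V. \<forall>w\<in>W. L (v \<otimes> w) = \<phi> (v, w))"
    by (rule tensor_space_universal[OF V W]) (use bil in \<open>simp_all add: bilinear_map_def\<close>)
  then obtain L where L: "Vector_Spaces.linear scaleC scaleC L"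
    and L\<phi>: "\<And>v w. v \<in> V \<Longrightarrow> w \<in> W \<Longrightarrow> L (v \<otimes> w) = \<phi> (v, w)" by blast
  interpret L: Vector_Spaces.linear scaleC scaleC L by fact
  have Xsub: "cvs.subspace X" and Xops: "X \<subseteq> bounded_ops" using X by (simp_all add: operator_space_def)
  have \<phi>X: "\<phi> (v, w) \<in> X" if "v \<in> V" "w \<in> W" for v w
    using bil that by (auto simp: bilinear_map_def)
  have "cvs.subspace {t. L t \<in> X}"
    by (rule cvs.subspaceI)
      (simp_all add: L.add L.scale L.zero cvs.subspace_0[OF Xsub] cvs.subspace_add[OF Xsub]
        cvs.subspace_scale[OF Xsub])
  then have "tensor_space V W \<subseteq> {t. L t \<in> X}"
    unfolding tensor_space_def by (intro cvs.span_minimal) (auto simp: L\<phi> \<phi>X)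
  then have LX: "L t \<in> X" if "t \<in> tensor_space V W" for t using that by blast
  have C: "op_mat_norm n (\<lambda>i j. L (u i j)) \<le> ?s * schur_norm V W n u"
    if "u \<in> mats n (tensor_space V W)" for n u
  proof (rule linear_bound_of_schur_bound[OF V W L _ SB_bound(1)[OF V W \<phi>] _ that])
    show "L (v \<otimes> w) \<in> bounded_ops" if "v \<in> V" "w \<in> W" for v w
      using \<phi>X[OF that] Xops L\<phi>[OF that] by auto
    fix n x y assume n: "n \<ge> 1" and x: "x \<in> mats n V" and y: "y \<in> mats n W"
    have "op_mat_norm n (\<lambda>i j. L (x i j \<otimes> y i j)) = op_mat_norm n (\<lambda>i j. \<phi> (x i j, y i j))"
      using x y by (intro mat_opnorm_cong) (simp add: mats_def L\<phi>)
    then show "op_mat_norm n (\<lambda>i j. L (x i j \<otimes> y i j)) \<le> ?s * op_mat_norm n x * op_mat_norm n y"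
      using SB_bound(2)[OF V W \<phi> n x y] by simp
  qed
  obtain \<psi> where lin: "linear_map (V \<otimes>\<^sup>s W) (opspace X) \<psi>"
    and \<psi>L: "\<And>t. t \<in> tensor_space V W \<Longrightarrow> \<psi> (schur_incl V W t) = L t"
    and bound: "\<And>n a. n \<ge> 1 \<Longrightarrow> a \<in> mats n (pts (V \<otimes>\<^sup>s W)) \<Longrightarrow>
          op_mat_norm n (\<lambda>i j. \<psi> (a i j)) \<le> ?s * mnorm (V \<otimes>\<^sup>s W) n a"
    using M.bounded_map_extension[OF X L LX C] unfolding schur_tensor_def schur_incl_def opspace_simps
    by metis
  show thesis
  proof (rule that[of \<psi>])
    show "\<psi> \<in> CB (V \<otimes>\<^sup>s W) (opspace X)" using lin bound by (auto simp: CB_def)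
    show "assoc_bilinear V W \<psi> = \<phi>"
    proof (rule extensionalityI[of _ "V \<times> W"])
      show "\<phi> \<in> extensional (V \<times> W)" using bil by (auto simp: bilinear_map_def PiE_def)
      show "assoc_bilinear V W \<psi> p = \<phi> p" if "p \<in> V \<times> W" for p
        using that by (auto simp: assoc_bilinear_apply \<psi>L tensor_in_space L\<phi>)
    qed (simp add: assoc_bilinear_def)
  qed (rule bound)
qed

text \<open>The extension of \<open>assoc_bilinear V W \<psi>\<close> has the schur norm as a complete bound, and by injectivity
  it is \<open>\<psi>\<close> itself.\<close>

lemma cb_norm_le_sb_norm:
  assumes X: "operator_space X" and \<psi>: "\<psi> \<in> CB (V \<otimes>\<^sup>s W) (opspace X)"
  shows "cb_norm (V \<otimes>\<^sup>s W) (opspace X) \<psi> \<le>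
           sb_norm (opspace V) (opspace W) (opspace X) (assoc_bilinear V W \<psi>)" (is "_ \<le> ?s")
proof -
  note SB = assoc_bilinear_in_SB[OF \<psi>]
  obtain \<psi>' where \<psi>': "\<psi>' \<in> CB (V \<otimes>\<^sup>s W) (opspace X)" "assoc_bilinear V W \<psi>' = assoc_bilinear V W \<psi>"
    and bound: "\<And>n a. n \<ge> 1 \<Longrightarrow> a \<in> mats n (pts (V \<otimes>\<^sup>s W)) \<Longrightarrow>
      op_mat_norm n (\<lambda>i j. \<psi>' (a i j)) \<le> ?s * mnorm (V \<otimes>\<^sup>s W) n a"
    using SB_extension[OF X SB] by metis
  have "\<psi>' = \<psi>" using inj_onD[OF assoc_bilinear_inj \<psi>'(2) \<psi>'(1) \<psi>] .
  note s = SB_bound(1)[OF V W SB]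
  show ?thesis
    unfolding cb_norm_def opspace_simps
  proof (intro cSUP_least)
    fix n :: nat assume n: "n \<in> {1..}"
    have "mnorm (V \<otimes>\<^sup>s W) n (\<lambda>i j. schur_incl V W (0 \<otimes> 0)) \<le> 0"
      using mnorm_schur_incl_le[of n "\<lambda>_ _. 0" "\<lambda>_ _. 0"] n cvs.subspace_0[OF V] cvs.subspace_0[OF W]
      by (simp add: mats_def op_mat_norm_zero)
    moreover have "(\<lambda>i j. schur_incl V W (0 \<otimes> 0)) \<in> mats n (pts (V \<otimes>\<^sup>s W))"
      using schur_incl_mats[of "\<lambda>_ _. 0" n "\<lambda>_ _. 0"] cvs.subspace_0[OF V] cvs.subspace_0[OF W]
      by (simp add: mats_def)
    ultimately show "{x \<in> mats n (pts (V \<otimes>\<^sup>s W)). mnorm (V \<otimes>\<^sup>s W) n x \<le> 1} \<noteq> {}"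
      by (auto intro: order_trans)
    fix a assume a: "a \<in> {x \<in> mats n (pts (V \<otimes>\<^sup>s W)). mnorm (V \<otimes>\<^sup>s W) n x \<le> 1}"
    have "op_mat_norm n (\<lambda>i j. \<psi> (a i j)) \<le> ?s * mnorm (V \<otimes>\<^sup>s W) n a"
      using bound a n by (simp add: \<open>\<psi>' = \<psi>\<close>)
    also have "\<dots> \<le> ?s * 1" using a s by (intro mult_left_mono) auto
    finally show "op_mat_norm n (\<lambda>i j. \<psi> (a i j)) \<le> ?s" by simp
  qed simp
qed

end

theorem proposition2p4:
  fixes V :: "('h::chilbert_space \<Rightarrow>\<^sub>L 'h) set"
    and W :: "('k::chilbert_space \<Rightarrow>\<^sub>L 'k) set"
    and X :: "('l::chilbert_space \<Rightarrow>\<^sub>L 'l) set"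
  assumes "operator_space V" and "operator_space W" and "operator_space X"
  shows "bij_betw (assoc_bilinear V W)
           (CB (V \<otimes>\<^sup>s W) (opspace X)) (SB (opspace V) (opspace W) (opspace X))
       \<and> (\<forall>\<psi>1\<in>CB (V \<otimes>\<^sup>s W) (opspace X). \<forall>\<psi>2\<in>CB (V \<otimes>\<^sup>s W) (opspace X). \<forall>a b.
            assoc_bilinear V W (\<lambda>z\<in>pts (V \<otimes>\<^sup>s W). a *\<^sub>C \<psi>1 z + b *\<^sub>C \<psi>2 z) =
              (\<lambda>p\<in>V \<times> W. a *\<^sub>C assoc_bilinear V W \<psi>1 p + b *\<^sub>C assoc_bilinear V W \<psi>2 p))
       \<and> (\<forall>\<psi>\<in>CB (V \<otimes>\<^sup>s W) (opspace X).
            sb_norm (opspace V) (opspace W) (opspace X) (assoc_bilinear V W \<psi>) =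
              cb_norm (V \<otimes>\<^sup>s W) (opspace X) \<psi>)"
proof (intro conjI ballI allI)
  have V: "cvs.subspace V" and W: "cvs.subspace W"
    using assms(1,2) by (simp_all add: operator_space_def)
  show "bij_betw (assoc_bilinear V W)
      (CB (V \<otimes>\<^sup>s W) (opspace X)) (SB (opspace V) (opspace W) (opspace X))"
    unfolding bij_betw_def
  proof (intro conjI assoc_bilinear_inj V W subset_antisym subsetI)
    show "\<phi> \<in> SB (opspace V) (opspace W) (opspace X)"
      if "\<phi> \<in> assoc_bilinear V W ` CB (V \<otimes>\<^sup>s W) (opspace X)" for \<phi>
      using that assoc_bilinear_in_SB[OF V W] by blast
    show "\<phi> \<in> assoc_bilinear V W ` CB (V \<otimes>\<^sup>s W) (opspace X)"
      if "\<phi> \<in> SB (opspace V) (opspace W) (opspace X)" for \<phi>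
      by (rule SB_extension[OF V W assms(3) that]) blast
  qed
  show "assoc_bilinear V W (\<lambda>z\<in>pts (V \<otimes>\<^sup>s W). a *\<^sub>C \<psi>1 z + b *\<^sub>C \<psi>2 z) =
      (\<lambda>p\<in>V \<times> W. a *\<^sub>C assoc_bilinear V W \<psi>1 p + b *\<^sub>C assoc_bilinear V W \<psi>2 p)"
    for \<psi>1 \<psi>2 :: "_ \<Rightarrow> 'l \<Rightarrow>\<^sub>L 'l" and a b
    using schur_incl_in_pts[OF V W tensor_in_space[OF V W]]
    by (auto simp: assoc_bilinear_def fun_eq_iff restrict_def)
  show "sb_norm (opspace V) (opspace W) (opspace X) (assoc_bilinear V W \<psi>) =
      cb_norm (V \<otimes>\<^sup>s W) (opspace X) \<psi>" if "\<psi> \<in> CB (V \<otimes>\<^sup>s W) (opspace X)" for \<psi>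
    by (rule antisym[OF sb_norm_le_cb_norm[OF V W that] cb_norm_le_sb_norm[OF V W assms(3) that]])
qed

end
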